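(* Let $K\subseteq\mathbb{R}$ be compact. (a) If $f:K\rightrightarrows\mathbb{R}$ is a total multifunction that is computable relative to some oracle, then $f$ is Henkin-continuous. (b) More precisely, suppose $F:\subseteq\{0,1\}^\omega\rightrightarrows\{0,1\}^\omega$ is a Henkin-continuous $(\rho_{\mathrm{sd}},\rho_{\mathrm{sd}})$-multirealizer of a total multifunction $f:K\rightrightarrows\mathbb{R}$, and that $F$ maps compact sets to compact sets. Then $f$ itself is Henkin-continuous, and $f$ has a Henkin-continuous tightening $g:K\rightrightarrows\mathbb{R}$ which maps compact sets to compact sets. (c) Conversely, if a total multifunction $f:K\rightrightarrows\mathbb{R}$ is Henkin-continuous and maps compact sets to compact sets, then $F:=\rho_{\mathrm{sd}}^{-1}\circ f\circ\rho_{\mathrm{sd}}|^K$ is a Henkin-continuous $(\rho_{\mathrm{sd}},\rho_{\mathrm{sd}})$-multirealizer of $f$ which maps compact sets to compact sets.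
   Context: Multifunctions. A multifunction $f:\subseteq X\rightrightarrows Y$ is a relation $f\subseteq X\times Y$; $f(x)=\{y:(x,y)\in f\}$, $\mathrm{dom}(f)=\{x:f(x)\neq\emptyset\}$, $f[S]=\bigcup_{x\in S}f(x)$. It is total (written $f:X\rightrightarrows Y$) if $\mathrm{dom}(f)=X$. The inverse is $f^{-1}=\{(y,x):(x,y)\in f\}$; $f|^B=f\cap(X\times B)$. A multifunction $g$ tightens $f$ (is a tightening of $f$) if $\mathrm{dom}(f)\subseteq\mathrm{dom}(g)$ and $g(x)\subseteq f(x)$ for all $x\in\mathrm{dom}(f)$. Composition of $f:\subseteq X\rightrightarrows Y$ and $g:\subseteq Y\rightrightarrows Z$: $g\circ f=\{(x,z): f(x)\subseteq\mathrm{dom}(g),\ \exists y:(x,y)\in f\wedge(y,z)\in g\}$. "$f$ maps compact sets to compact sets" means $f[S]$ is compact for every compact $S\subseteq\mathrm{dom}(f)$. Henkin-continuity. For metric spaces $X,Y$ with open balls $B(\cdot,\cdot)$, $f:\subseteq X\rightrightarrows Y$ is Henkin-continuous if there are a function $\delta:(0,\infty)\to(0,\infty)$ and a choice $y:\mathrm{dom}(f)\to Y$ with $y(x)\in f(x)$ (so $\delta$ depends on $\varepsilon$ but not on $x$, and $y$ depends on $x$ but not on $\varepsilon$) such that for all $\varepsilon>0$, all $x\in\mathrm{dom}(f)$ and all $x'\in B(x,\delta(\varepsilon))\cap\mathrm{dom}(f)$ there is $y'\in B(y(x),\varepsilon)\cap f(x')$. Cantor space $\{0,1\}^\omega$ carries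 the metric $d(\bar\sigma,\bar\tau)=2^{-\min\{n:\sigma_n\ne\tau_n\}}$ for $\bar\sigma\neq\bar\tau$. Signed digit representation $\rho_{\mathrm{sd}}:\subseteq\{0,1\}^\omega\to\mathbb{R}$: a name of $x$ is (the encoding, each symbol of $\{0,1,\bar1,.\}$ being coded by a fixed binary string of a common constant length, of) a sequence $a_na_{n-1}\cdots a_0\,.\,a_{-1}a_{-2}\cdots$ with $n\ge-1$, digits $a_i\in\{0,1,\bar1\}$ where $\bar1$ stands for $-1$, $a_n\ne0$ if $n\geq0$, $a_na_{n-1}\notin\{1\bar1,\bar11\}$ if $n\ge1$, and $x=\sum_{i\leq n}a_i2^{i}$. Multirealizer. $F:\subseteq\{0,1\}^\omega\rightrightarrows\{0,1\}^\omega$ is a $(\rho_{\mathrm{sd}},\rho_{\mathrm{sd}})$-multirealizer of $f$ if $F$ tightens $\rho_{\mathrm{sd}}^{-1}\circ f\circ\rho_{\mathrm{sd}}$ (equivalently, $\rho_{\mathrm{sd}}\circ F\circ\rho_{\mathrm{sd}}^{-1}$ tightens $f$). Relative computability. $f:\subseteq\mathbb{R}\rightrightarrows\mathbb{R}$ is computable relative to an oracle if some oracle Turing machine (with that oracle), given any sequence of integer fractions $a_n/b_n$ with $|x-a_n/b_n|\le2^{-n}$ for all $n\in\mathbb N$ and some $x\in\mathrm{dom}(f)$, outputs a sequence of integer fractions $u_m/v_m$ with $|y-u_m/v_m|\le2^{-m}$ for all $m\in\mathbb N$ and some $y\in f(x)$ (where $y$ may depend on the given sequence). Equivalently, $f$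 has a $(\rho_{\mathrm{sd}},\rho_{\mathrm{sd}})$-realizer (a single-valued function sending every $\rho_{\mathrm{sd}}$-name of every $x\in\mathrm{dom}(f)$ to a $\rho_{\mathrm{sd}}$-name of some $y\in f(x)$) computable relative to the oracle; $f$ is computable relative to some oracle iff it has a continuous such realizer. *)

theory Defs
  imports "HOL-Analysis.Analysis"
begin

text \<open>
  A multifunction is a relation. Its domain is \<open>Domain f\<close>, its value at \<open>x\<close> is
  \<open>f `` {x}\<close>, its inverse is the converse relation, and a total multifunction
  from \<open>K\<close> is a relation \<open>f\<close> with \<open>Domain f = K\<close>.
\<close>

definition tightens :: "('a \<times> 'b) set \<Rightarrow> ('a \<times> 'b) set \<Rightarrow> bool" where
  "tightens g f \<longleftrightarrow> Domain f \<subseteq> Domain g \<and> (\<forall>x \<in> Domain f. g `` {x} \<subseteq> f `` {x})"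

text \<open>Unlike for relational composition, all values of \<open>f\<close> at \<open>x\<close> must lie in the domain of \<open>g\<close>.\<close>

definition mcomp :: "('b \<times> 'c) set \<Rightarrow> ('a \<times> 'b) set \<Rightarrow> ('a \<times> 'c) set"  (infixl "\<circ>\<^sub>m\<^sub>f" 55) where
  "g \<circ>\<^sub>m\<^sub>f f = {(x, z). f `` {x} \<subseteq> Domain g \<and> (\<exists>y. (x, y) \<in> f \<and> (y, z) \<in> g)}"

definition corestrict :: "('a \<times> 'b) set \<Rightarrow> 'b set \<Rightarrow> ('a \<times> 'b) set" where
  "corestrict f B = f \<inter> (UNIV \<times> B)"

definition compact_to_compact :: "('a::topological_space \<times> 'b::topological_space) set \<Rightarrow> bool" where
  "compact_to_compact f \<longleftrightarrow> (\<forall>S. S \<subseteq> Domain f \<and> compact S \<longrightarrow> compact (f `` S))"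

definition Henkin_continuous :: "('a::metric_space \<times> 'b::metric_space) set \<Rightarrow> bool" where
  "Henkin_continuous f \<longleftrightarrow>
     (\<exists>(\<delta> :: real \<Rightarrow> real) (y :: 'a \<Rightarrow> 'b).
        (\<forall>\<epsilon>>0. \<delta> \<epsilon> > 0) \<and>
        (\<forall>x \<in> Domain f. y x \<in> f `` {x}) \<and>
        (\<forall>\<epsilon>>0. \<forall>x \<in> Domain f. \<forall>x' \<in> ball x (\<delta> \<epsilon>) \<inter> Domain f.
           \<exists>y'. y' \<in> ball (y x) \<epsilon> \<inter> f `` {x'}))"

text \<open>A separate type, since the function type carries a different metric in the library.\<close>

datatype cantor = Cantor (bit_at: "nat \<Rightarrow> bool")

instantiation cantor :: metric_space
begin

definition dist_cantor :: "cantor \<Rightarrow> cantor \<Rightarrow> real" where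
  "dist p q = (if p = q then 0 else (1/2) ^ (LEAST n. bit_at p n \<noteq> bit_at q n))"

definition uniformity_cantor :: "(cantor \<times> cantor) filter" where
  "uniformity = (INF e\<in>{0<..}. principal {(p :: cantor, q). dist p q < e})"

definition open_cantor :: "cantor set \<Rightarrow> bool" where
  "open (U :: cantor set) \<longleftrightarrow> (\<forall>p\<in>U. \<forall>\<^sub>F (p', q) in uniformity. p' = p \<longrightarrow> q \<in> U)"

instance
proof
  fix p q r :: cantor
  show "dist p q = 0 \<longleftrightarrow> p = q"
    by (simp add: dist_cantor_def)
  show "dist p q \<le> dist p r + dist q r"
  proof (cases "p = q \<or> p = r \<or> q = r")
    case True
    moreover have "dist q p = dist p q"
      unfolding dist_cantor_def by (simp only: eq_commute[of q p] eq_commute[of "bit_at q _"])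
    moreover have "dist a b \<ge> 0" "dist a a = 0" for a b :: cantor
      by (auto simp: dist_cantor_def)
    ultimately show ?thesis
      by auto
  next
    case False
    define m where "m = (LEAST n. bit_at p n \<noteq> bit_at q n)"
    have "\<exists>n. bit_at p n \<noteq> bit_at q n"
      using False by (cases p; cases q) auto
    then have "bit_at p m \<noteq> bit_at q m"
      unfolding m_def by (rule LeastI_ex)
    then consider "bit_at p m \<noteq> bit_at r m" | "bit_at q m \<noteq> bit_at r m"
      by blast
    then show ?thesis
    proof cases
      case 1
      then have "(LEAST n. bit_at p n \<noteq> bit_at r n) \<le> m"
        by (rule Least_le)
      then have "(1/2 :: real) ^ m \<le> (1/2) ^ (LEAST n. bit_at p n \<noteq> bit_at r n)"
        by (intro power_decreasing) auto
      then show ?thesis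
        using False unfolding dist_cantor_def m_def[symmetric]
        by (simp add: add_increasing2)
    next
      case 2
      then have "(LEAST n. bit_at q n \<noteq> bit_at r n) \<le> m"
        by (rule Least_le)
      then have "(1/2 :: real) ^ m \<le> (1/2) ^ (LEAST n. bit_at q n \<noteq> bit_at r n)"
        by (intro power_decreasing) auto
      then show ?thesis
        using False unfolding dist_cantor_def m_def[symmetric]
        by (simp add: add_increasing)
    qed
  qed
qed (rule uniformity_cantor_def open_cantor_def)+

end

datatype sd_symbol = Zero | One | MinusOne | Point

fun digit_value :: "sd_symbol \<Rightarrow> real" where
  "digit_value Zero = 0"
| "digit_value One = 1"
| "digit_value MinusOne = -1"
| "digit_value Point = 0"  \<comment> \<open>irrelevant value\<close>

text \<open>
  \<open>sd_expansion w x\<close>: the symbol sequence \<open>w\<close> is \<open>a\<^sub>n \<dots> a\<^sub>0 . a\<^sub>-\<^sub>1 a\<^sub>-\<^sub>2 \<dots>\<close> and has value \<open>x\<close>.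
\<close>

definition sd_expansion :: "(nat \<Rightarrow> sd_symbol) \<Rightarrow> real \<Rightarrow> bool" where
  "sd_expansion w x \<longleftrightarrow>
     (\<exists>(n :: int) (a :: int \<Rightarrow> sd_symbol).
        n \<ge> -1 \<and>
        (\<forall>i. a i \<noteq> Point) \<and>
        (n \<ge> 0 \<longrightarrow> a n \<noteq> Zero) \<and>
        (n \<ge> 1 \<longrightarrow> (a n, a (n - 1)) \<notin> {(One, MinusOne), (MinusOne, One)}) \<and>
        (\<forall>k. w k = (if int k \<le> n then a (n - int k)
                     else if int k = n + 1 then Point
                     else a (n + 1 - int k))) \<and>
        ((\<lambda>i. digit_value (a i) * 2 powi i) has_sum x) {..n})"

definition block_code :: "(sd_symbol \<Rightarrow> bool list) \<Rightarrow> bool" where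
  "block_code c \<longleftrightarrow> inj c \<and> (\<exists>l. \<forall>s. length (c s) = l)"

text \<open>The block length \<open>length (c (w k))\<close> is constant when \<open>block_code c\<close> holds.\<close>

definition encodes :: "(sd_symbol \<Rightarrow> bool list) \<Rightarrow> cantor \<Rightarrow> (nat \<Rightarrow> sd_symbol) \<Rightarrow> bool" where
  "encodes c p w \<longleftrightarrow>
     (\<forall>k. \<forall>j < length (c (w k)). bit_at p (k * length (c (w k)) + j) = c (w k) ! j)"

definition rho_sd :: "(sd_symbol \<Rightarrow> bool list) \<Rightarrow> (cantor \<times> real) set" where
  "rho_sd c = {(p, x). \<exists>w. encodes c p w \<and> sd_expansion w x}"

definition multirealizer ::
    "(sd_symbol \<Rightarrow> bool list) \<Rightarrow> (cantor \<times> cantor) set \<Rightarrow> (real \<times> real) set \<Rightarrow> bool" where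
  "multirealizer c F f \<longleftrightarrow> tightens F ((rho_sd c)\<inverse> \<circ>\<^sub>m\<^sub>f f \<circ>\<^sub>m\<^sub>f rho_sd c)"

text \<open>
  A deterministic machine with a read-only one-way input tape, a two-way infinite work tape,
  a write-only output tape and a write-only query tape. The oracle is a set of binary words;
  asking it stores the answer in a flag, which the transition function can read, and erases
  the query tape.
\<close>

datatype head_move = MoveLeft | MoveStay | MoveRight

fun move_head :: "head_move \<Rightarrow> int \<Rightarrow> int" where
  "move_head MoveLeft h = h - 1"
| "move_head MoveStay h = h"
| "move_head MoveRight h = h + 1"

datatype query_action = NoQuery | WriteQuery bool | AskOracle

record 's action =
  next_state :: nat
  write_symbol :: nat
  work_move :: head_move
  advance_input :: bool
  query_act :: query_action
  emit :: "'s option"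

text \<open>
  States are \<open>{..<num_states}\<close> with initial state \<open>0\<close>, work tape symbols are
  \<open>{..<num_symbols}\<close> with blank \<open>0\<close>. The arguments of \<open>transition\<close> are the state, the scanned
  input symbol, the scanned work tape symbol and the last oracle answer. \<open>'s\<close> is the input and
  output alphabet.
\<close>

record 's machine =
  num_states :: nat
  num_symbols :: nat
  transition :: "nat \<Rightarrow> 's \<Rightarrow> nat \<Rightarrow> bool \<Rightarrow> 's action"

definition valid_machine :: "'s machine \<Rightarrow> bool" where
  "valid_machine M \<longleftrightarrow>
     finite (UNIV :: 's set) \<and> 0 < num_states M \<and> 0 < num_symbols M \<and>
     (\<forall>q < num_states M. \<forall>s. \<forall>g < num_symbols M. \<forall>b.
        next_state (transition M q s g b) < num_states M \<and>
        write_symbol (transition M q s g b) < num_symbols M)"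

record 's config =
  cur_state :: nat
  input_pos :: nat
  work_tape :: "int \<Rightarrow> nat"
  work_pos :: int
  query_tape :: "bool list"
  oracle_answer :: bool
  output_tape :: "'s list"

definition initial_config :: "'s config" where
  "initial_config =
     \<lparr>cur_state = 0, input_pos = 0, work_tape = (\<lambda>_. 0), work_pos = 0,
      query_tape = [], oracle_answer = False, output_tape = []\<rparr>"

definition step ::
    "'s machine \<Rightarrow> bool list set \<Rightarrow> (nat \<Rightarrow> 's) \<Rightarrow> 's config \<Rightarrow> 's config" where
  "step M A inp C =
     (let act = transition M (cur_state C) (inp (input_pos C))
                  (work_tape C (work_pos C)) (oracle_answer C)
      in \<lparr>cur_state = next_state act,
          input_pos = (if advance_input act then input_pos C + 1 else input_pos C),
          work_tape = (work_tape C)(work_pos C := write_symbol act),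
          work_pos = move_head (work_move act) (work_pos C),
          query_tape = (case query_act act of
                          NoQuery \<Rightarrow> query_tape C
                        | WriteQuery b \<Rightarrow> query_tape C @ [b]
                        | AskOracle \<Rightarrow> []),
          oracle_answer = (case query_act act of
                             AskOracle \<Rightarrow> query_tape C \<in> A
                           | _ \<Rightarrow> oracle_answer C),
          output_tape = (case emit act of
                           None \<Rightarrow> output_tape C
                         | Some s \<Rightarrow> output_tape C @ [s])\<rparr>)"

definition run ::
    "'s machine \<Rightarrow> bool list set \<Rightarrow> (nat \<Rightarrow> 's) \<Rightarrow> nat \<Rightarrow> 's config" where
  "run M A inp t = (step M A inp ^^ t) initial_config"

text \<open>The machine writes the infinite sequence \<open>out\<close>; the output tape only ever grows.\<close>

definition produces ::
    "'s machine \<Rightarrow> bool list set \<Rightarrow> (nat \<Rightarrow> 's) \<Rightarrow> (nat \<Rightarrow> 's) \<Rightarrow> bool" where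
  "produces M A inp out \<longleftrightarrow>
     (\<forall>k. \<exists>t. k < length (output_tape (run M A inp t)) \<and>
              output_tape (run M A inp t) ! k = out k)"

datatype frac_symbol = Bit bool | Minus | Slash | Comma

fun nat_word :: "nat \<Rightarrow> frac_symbol list" where
  "nat_word n = (if n < 2 then [Bit (n = 1)] else nat_word (n div 2) @ [Bit (odd n)])"

declare nat_word.simps [simp del]

definition int_word :: "int \<Rightarrow> frac_symbol list" where
  "int_word i = (if i < 0 then Minus # nat_word (nat (- i)) else nat_word (nat i))"

text \<open>A fraction \<open>a/b\<close> is the pair \<open>(a, b)\<close>; it need not be in lowest terms.\<close>

definition frac_word :: "int \<times> int \<Rightarrow> frac_symbol list" where
  "frac_word r = int_word (fst r) @ [Slash] @ int_word (snd r) @ [Comma]"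

text \<open>
  The infinite concatenation of the words of the fractions. As all these words are nonempty,
  the symbol at position \<open>k\<close> already occurs in the first \<open>k + 1\<close> of them.
\<close>

definition frac_tape :: "(nat \<Rightarrow> int \<times> int) \<Rightarrow> nat \<Rightarrow> frac_symbol" where
  "frac_tape r k = concat (map (\<lambda>i. frac_word (r i)) [0..<Suc k]) ! k"

definition approximates :: "(nat \<Rightarrow> int \<times> int) \<Rightarrow> real \<Rightarrow> bool" where
  "approximates r x \<longleftrightarrow>
     (\<forall>n. snd (r n) \<noteq> 0 \<and> \<bar>x - of_int (fst (r n)) / of_int (snd (r n))\<bar> \<le> 1 / 2 ^ n)"

definition computable_relative :: "bool list set \<Rightarrow> (real \<times> real) set \<Rightarrow> bool" where
  "computable_relative A f \<longleftrightarrow>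
     (\<exists>M. valid_machine M \<and>
        (\<forall>x \<in> Domain f. \<forall>r. approximates r x \<longrightarrow>
           (\<exists>u. produces M A (frac_tape r) (frac_tape u) \<and>
                (\<exists>y \<in> f `` {x}. approximates u y))))"

end

theory Submission imports Defs begin

text \<open>
  Write \<open>\<rho>\<close> for the signed digit representation. Everything rests on one closure property: if every
  value of \<open>h\<close> lies in the domain of \<open>g\<close>, then Henkin-continuity passes from \<open>h\<close> and \<open>g\<close> to their
  composition (\<open>Henkin_continuous_relcomp\<close>), and so does mapping compact sets to compact sets. It
  remains to see that the factors have these properties.

  The two non-trivial factors are \<open>\<rho>\<close> and its inverse. Single-valuedness and continuity of \<open>\<rho>\<close> are
  clear, since a prefix of a name reveals the exponent and then the first digits. The normalization
  of the leading digits bounds the exponent of any name of \<open>x\<close> in terms of \<open>\<bar>x\<bar>\<close>, and this makes the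
  preimage of a compact set compact (\<open>compact_rho_sd_preimage\<close>). On that preimage \<open>\<rho>\<close> is
  uniformly continuous, hence Henkin-continuous. The inverse is Henkin-continuous
  on the whole line (\<open>Henkin_continuous_rho_sd_converse\<close>): every \<open>x\<close> has a canonical name,
  produced by choosing the nearest digit at each step, all whose remainders stay in
  \<open>[-3/4, 3/4]\<close>. As digits can represent any remainder in \<open>[-1, 1]\<close>, a margin of \<open>1/4\<close> is left, so
  that each prefix of this one name is also a prefix of a name of every \<open>x'\<close> sufficiently close to
  \<open>x\<close>, where how close it has to be depends only on the length of the prefix.

  Conversely, given a Henkin-continuous and compactness preserving \<open>f\<close>, its realizer is the
  composition of \<open>\<rho>\<close> restricted to names of points of \<open>K\<close>, of \<open>f\<close>, and of the inverse of \<open>\<rho>\<close>. Given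
  a realizer \<open>F\<close> instead, the inverse of \<open>\<rho>\<close>, followed by \<open>F\<close> and by \<open>\<rho>\<close> restricted to the
  compact set of all values of \<open>F\<close> on names of points of \<open>K\<close>, is the desired tightening of \<open>f\<close>.

  Finally, let \<open>f\<close> be computed by an oracle machine. From a name of \<open>x\<close> one can choose approximating
  fractions each of which depends only on a prefix of the name; running the machine on them selects a
  value of \<open>f\<close> at \<open>x\<close>, and this value depends continuously on the name because a finite part of the
  output is determined by a finite part of the input (\<open>computable_relative_selection\<close>). The names
  of points of \<open>K\<close> form a compact set, so the selection is uniformly continuous there, and \<open>f\<close> is
  tightened by the inverse of \<open>\<rho>\<close> followed by the selection.
\<close>

section \<open>Henkin-continuity under composition\<close>

lemma Henkin_continuousE:
  assumes "Henkin_continuous f"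
  obtains \<delta> y where "\<And>\<epsilon>. \<epsilon> > 0 \<Longrightarrow> \<delta> \<epsilon> > (0::real)" "\<And>x. x \<in> Domain f \<Longrightarrow> (x, y x) \<in> f"
    "\<And>\<epsilon> x x'. \<epsilon> > 0 \<Longrightarrow> x \<in> Domain f \<Longrightarrow> x' \<in> Domain f \<Longrightarrow> dist x x' < \<delta> \<epsilon> \<Longrightarrow>
       \<exists>y'. (x', y') \<in> f \<and> dist (y x) y' < \<epsilon>"
proof -
  obtain \<delta> y where "\<forall>\<epsilon>>0. \<delta> \<epsilon> > 0" "\<forall>x \<in> Domain f. y x \<in> f `` {x}"
    "\<forall>\<epsilon>>0. \<forall>x \<in> Domain f. \<forall>x' \<in> ball x (\<delta> \<epsilon>) \<inter> Domain f. \<exists>y'. y' \<in> ball (y x) \<epsilon> \<inter> f `` {x'}"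
    using assms unfolding Henkin_continuous_def by blast
  then show thesis
    by (intro that[of \<delta> y]) (simp_all add: Ball_def conj_commute)
qed

lemma Henkin_continuousI:
  assumes "\<And>\<epsilon>. \<epsilon> > 0 \<Longrightarrow> \<delta> \<epsilon> > (0::real)" "\<And>x. x \<in> Domain f \<Longrightarrow> (x, y x) \<in> f"
    "\<And>\<epsilon> x x'. \<epsilon> > 0 \<Longrightarrow> x \<in> Domain f \<Longrightarrow> x' \<in> Domain f \<Longrightarrow> dist x x' < \<delta> \<epsilon> \<Longrightarrow>
       \<exists>y'. (x', y') \<in> f \<and> dist (y x) y' < \<epsilon>"
  shows "Henkin_continuous f"
  unfolding Henkin_continuous_def
  by (rule exI[of _ \<delta>], rule exI[of _ y]) (use assms in \<open>simp add: Ball_def conj_commute\<close>)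

lemma Domain_relcomp_if_total: "Range h \<subseteq> Domain g \<Longrightarrow> Domain (h O g) = Domain h"
  by blast

text \<open>
  The chosen values compose because the choice of \<open>g\<close> is made at the single point chosen by \<open>h\<close>; the
  moduli compose as for uniformly continuous functions. The domain condition keeps the neighbouring
  values of \<open>h\<close>, over which there is no control, inside the domain of \<open>g\<close>.
\<close>

lemma Henkin_continuous_relcomp:
  assumes "Henkin_continuous h" and "Henkin_continuous g" and sub: "Range h \<subseteq> Domain g"
  shows "Henkin_continuous (h O g)"
proof -
  obtain dh yh where h: "\<And>\<epsilon>. \<epsilon> > 0 \<Longrightarrow> dh \<epsilon> > 0" "\<And>x. x \<in> Domain h \<Longrightarrow> (x, yh x) \<in> h"
    "\<And>\<epsilon> x x'. \<epsilon> > 0 \<Longrightarrow> x \<in> Domain h \<Longrightarrow> x' \<in> Domain h \<Longrightarrow> dist x x' < dh \<epsilon> \<Longrightarrow>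
       \<exists>y'. (x', y') \<in> h \<and> dist (yh x) y' < \<epsilon>"
    using Henkin_continuousE[OF assms(1)] by blast
  obtain dg yg where g: "\<And>\<epsilon>. \<epsilon> > 0 \<Longrightarrow> dg \<epsilon> > 0" "\<And>x. x \<in> Domain g \<Longrightarrow> (x, yg x) \<in> g"
    "\<And>\<epsilon> x x'. \<epsilon> > 0 \<Longrightarrow> x \<in> Domain g \<Longrightarrow> x' \<in> Domain g \<Longrightarrow> dist x x' < dg \<epsilon> \<Longrightarrow>
       \<exists>y'. (x', y') \<in> g \<and> dist (yg x) y' < \<epsilon>"
    using Henkin_continuousE[OF assms(2)] by blast
  have dom: "x \<in> Domain h" if "x \<in> Domain (h O g)" for x
    using that by auto
  show ?thesis
  proof (rule Henkin_continuousI[where \<delta> = "\<lambda>\<epsilon>. dh (dg \<epsilon>)" and y = "\<lambda>x. yg (yh x)"])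
    show "dh (dg \<epsilon>) > 0" if "\<epsilon> > 0" for \<epsilon>
      using that h(1) g(1) by simp
    show "(x, yg (yh x)) \<in> h O g" if "x \<in> Domain (h O g)" for x
      using h(2)[OF dom[OF that]] g(2) sub by blast
    fix \<epsilon> x x'
    assume e: "\<epsilon> > 0" and x: "x \<in> Domain (h O g)" "x' \<in> Domain (h O g)" "dist x x' < dh (dg \<epsilon>)"
    obtain y' where y': "(x', y') \<in> h" "dist (yh x) y' < dg \<epsilon>"
      using h(3)[OF g(1)[OF e] dom[OF x(1)] dom[OF x(2)] x(3)] by blast
    have "yh x \<in> Domain g" "y' \<in> Domain g"
      using sub y'(1) h(2)[OF dom[OF x(1)]] by auto
    then obtain z' where "(y', z') \<in> g" "dist (yg (yh x)) z' < \<epsilon>"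
      using g(3)[OF e _ _ y'(2)] by blast
    then show "\<exists>z'. (x', z') \<in> h O g \<and> dist (yg (yh x)) z' < \<epsilon>"
      using y'(1) by blast
  qed
qed

text \<open>
  Restricting a multifunction to a smaller domain is also covered: the restriction is tightened by
  the original.
\<close>

lemma Henkin_continuous_if_tightening:
  assumes "Henkin_continuous g" and t: "tightens g f"
  shows "Henkin_continuous f"
proof -
  obtain \<delta> y where g: "\<And>\<epsilon>. \<epsilon> > 0 \<Longrightarrow> \<delta> \<epsilon> > 0" "\<And>x. x \<in> Domain g \<Longrightarrow> (x, y x) \<in> g"
    "\<And>\<epsilon> x x'. \<epsilon> > 0 \<Longrightarrow> x \<in> Domain g \<Longrightarrow> x' \<in> Domain g \<Longrightarrow> dist x x' < \<delta> \<epsilon> \<Longrightarrow>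
       \<exists>y'. (x', y') \<in> g \<and> dist (y x) y' < \<epsilon>"
    using Henkin_continuousE[OF assms(1)] by blast
  have sub: "x \<in> Domain g" "(x, z) \<in> g \<Longrightarrow> (x, z) \<in> f" if "x \<in> Domain f" for x z
    using t that unfolding tightens_def by blast+
  show ?thesis
    by (rule Henkin_continuousI[where \<delta> = \<delta> and y = y]) (use g sub in \<open>meson+\<close>)
qed

lemma Henkin_continuous_graph:
  assumes "uniformly_continuous_on A h"
  shows "Henkin_continuous {(x, h x) | x. x \<in> A}"
proof -
  have "\<forall>\<epsilon>. \<exists>d. \<epsilon> > 0 \<longrightarrow> d > 0 \<and> (\<forall>x\<in>A. \<forall>x'\<in>A. dist x' x < d \<longrightarrow> dist (h x') (h x) < \<epsilon>)"
    using assms unfolding uniformly_continuous_on_def by blast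
  then obtain d where d: "\<And>\<epsilon>. \<epsilon> > 0 \<Longrightarrow>
      d \<epsilon> > 0 \<and> (\<forall>x\<in>A. \<forall>x'\<in>A. dist x' x < d \<epsilon> \<longrightarrow> dist (h x') (h x) < \<epsilon>)"
    by metis
  show ?thesis
    unfolding Henkin_continuous_def
    by (rule exI[of _ d], rule exI[of _ h]) (use d in \<open>auto simp: dist_commute\<close>)
qed

lemma compact_to_compact_relcomp:
  assumes "compact_to_compact h" "compact_to_compact g" and sub: "Range h \<subseteq> Domain g"
  shows "compact_to_compact (h O g)"
  unfolding compact_to_compact_def
proof (intro allI impI)
  fix S assume S: "S \<subseteq> Domain (h O g) \<and> compact S"
  then have "S \<subseteq> Domain h" by blast
  then have "compact (h `` S)"
    using S assms(1) by (auto simp: compact_to_compact_def)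
  moreover have "h `` S \<subseteq> Domain g"
    using sub by blast
  ultimately have "compact (g `` (h `` S))"
    using assms(2) by (auto simp: compact_to_compact_def)
  then show "compact ((h O g) `` S)"
    by (simp add: relcomp_Image)
qed

lemma compact_to_compact_graph:
  assumes "continuous_on A h"
  shows "compact_to_compact {(x, h x) | x. x \<in> A}"
  unfolding compact_to_compact_def
proof (intro allI impI)
  fix S assume S: "S \<subseteq> Domain {(x, h x) | x. x \<in> A} \<and> compact S"
  then have "{(x, h x) | x. x \<in> A} `` S = h ` S"
    by auto
  moreover have "continuous_on S h"
    using S assms by (auto intro: continuous_on_subset)
  ultimately show "compact ({(x, h x) | x. x \<in> A} `` S)"
    using S by (simp add: compact_continuous_image)
qed

section \<open>Cantor space\<close>

text \<open>
  This replaces the least differing index in the metric by agreement of prefixes, which is the only way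
  the metric is used below.
\<close>

lemma dist_cantor_le_iff:
  fixes p q :: cantor
  shows "dist p q \<le> (1/2) ^ m \<longleftrightarrow> (\<forall>i<m. bit_at p i = bit_at q i)"
proof (cases "p = q")
  case False
  then have ex: "\<exists>n. bit_at p n \<noteq> bit_at q n"
    by (cases p; cases q) auto
  define N where "N = (LEAST n. bit_at p n \<noteq> bit_at q n)"
  have "bit_at p N \<noteq> bit_at q N"
    unfolding N_def by (rule LeastI_ex[OF ex])
  moreover have "bit_at p i = bit_at q i" if "i < N" for i
    using that not_less_Least unfolding N_def by blast
  ultimately have "m \<le> N \<longleftrightarrow> (\<forall>i<m. bit_at p i = bit_at q i)"
    by (meson leI le_trans not_less)
  moreover have "dist p q = (1/2) ^ N"
    using False by (simp add: dist_cantor_def N_def)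
  ultimately show ?thesis
    by (simp add: power_decreasing_iff)
qed (simp add: dist_cantor_def)

lemma half_power_less:
  assumes "(e::real) > 0"
  obtains m where "(1/2) ^ m < e"
  using real_arch_pow_inv[OF assms, of "1/2"] by auto

lemma complete_cantor: "complete (UNIV :: cantor set)"
  unfolding complete_def
proof (intro allI impI)
  fix X :: "nat \<Rightarrow> cantor" assume "(\<forall>n. X n \<in> UNIV) \<and> Cauchy X"
  then have C: "Cauchy X" by simp
  have "\<exists>N. \<forall>i\<ge>N. \<forall>j\<ge>N. dist (X i) (X j) \<le> (1/2) ^ m" for m
  proof -
    have "(1/2::real) ^ m > 0" by simp
    then obtain N where "\<forall>i\<ge>N. \<forall>j\<ge>N. dist (X i) (X j) < (1/2) ^ m"
      using C unfolding Cauchy_def by blast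
    then show ?thesis
      using less_imp_le by blast
  qed
  then obtain N where N: "\<And>m i j. i \<ge> N m \<Longrightarrow> j \<ge> N m \<Longrightarrow> dist (X i) (X j) \<le> (1/2) ^ m"
    by metis
  define p where "p = Cantor (\<lambda>i. bit_at (X (N (Suc i))) i)"
  have p: "dist (X j) p \<le> (1/2) ^ m" if j: "j \<ge> N m" for j m
    unfolding dist_cantor_le_iff
  proof (intro allI impI)
    fix i assume i: "i < m"
    define k where "k = max (N m) (N (Suc i))"
    have "bit_at (X j) i = bit_at (X k) i"
      using N[of m j k] i j unfolding dist_cantor_le_iff by (auto simp: k_def)
    moreover have "bit_at (X k) i = bit_at (X (N (Suc i))) i"
      using N[of "Suc i" k "N (Suc i)"] unfolding dist_cantor_le_iff by (auto simp: k_def)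
    ultimately show "bit_at (X j) i = bit_at p i"
      by (simp add: p_def)
  qed
  have "X \<longlonglongrightarrow> p"
  proof (rule metric_LIMSEQ_I)
    fix r :: real assume "r > 0"
    then obtain m where "(1/2) ^ m < r" by (rule half_power_less)
    then show "\<exists>no. \<forall>n\<ge>no. dist (X n) p < r"
      using order.strict_trans1[OF p] by blast
  qed
  then show "\<exists>l\<in>UNIV. X \<longlonglongrightarrow> l" by blast
qed

lemma compact_cantor: "compact (UNIV :: cantor set)"
  unfolding compact_eq_totally_bounded
proof (intro conjI allI impI complete_cantor)
  fix e :: real assume "e > 0"
  then obtain m where m: "(1/2) ^ m < e" by (rule half_power_less)
  \<comment> \<open>The binary sequences that vanish from position \<open>m\<close> on form a finite net.\<close>
  define code where "code B = Cantor (\<lambda>i. i \<in> B)" for B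
  define Q where "Q = code ` Pow {..<m}"
  have "\<exists>q\<in>Q. p \<in> ball q e" for p
  proof
    define B where "B = {i. i < m \<and> bit_at p i}"
    show "code B \<in> Q"
      unfolding Q_def by (rule imageI) (simp add: B_def Collect_mono_iff lessThan_def)
    have "dist (code B) p \<le> (1/2) ^ m"
      unfolding dist_cantor_le_iff by (simp add: code_def B_def)
    then show "p \<in> ball (code B) e"
      using m by simp
  qed
  then have "UNIV \<subseteq> (\<Union>q\<in>Q. ball q e)"
    by (intro subsetI) (simp only: UN_iff)
  moreover have "finite Q" by (simp add: Q_def)
  ultimately show "\<exists>k. finite k \<and> (UNIV :: cantor set) \<subseteq> (\<Union>q\<in>k. ball q e)"
    by (intro exI[of _ Q] conjI)
qed

section \<open>Signed digit expansions\<close>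

text \<open>
  The value of an expansion whose first digit has weight \<open>1/2\<close>. Scaling by \<open>2 ^ n\<close> turns the first \<open>n\<close>
  digits into the integer part, so that all digit arguments can be made in \<open>[-1, 1]\<close>.
\<close>

definition digit_sum :: "(nat \<Rightarrow> sd_symbol) \<Rightarrow> real" where
  "digit_sum d = (\<Sum>k. digit_value (d k) * (1/2) ^ Suc k)"

lemma abs_digit_value: "\<bar>digit_value s\<bar> \<le> 1"
  by (cases s) auto

lemma summable_digits_norm: "summable (\<lambda>k. norm (digit_value (d k) * (1/2) ^ Suc k))"
proof (rule summable_comparison_test')
  show "summable (\<lambda>k. (1/2::real) ^ Suc k)"
    using power_half_series by (rule sums_summable)
  show "norm (norm (digit_value (d k) * (1/2) ^ Suc k)) \<le> (1/2) ^ Suc k" for k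
    using abs_digit_value[of "d k"] by (simp add: abs_mult mult_le_cancel_right2)
qed

lemma summable_digits: "summable (\<lambda>k. digit_value (d k) * (1/2) ^ Suc k)"
  using summable_digits_norm by (rule summable_norm_cancel)

lemma digit_sum_split:
  "digit_sum d = (\<Sum>j<k. digit_value (d j) * (1/2) ^ Suc j) + (1/2) ^ k * digit_sum (\<lambda>j. d (j + k))"
proof -
  have "digit_sum d = (\<Sum>j. digit_value (d (j + k)) * (1/2) ^ Suc (j + k)) +
      (\<Sum>j<k. digit_value (d j) * (1/2) ^ Suc j)"
    unfolding digit_sum_def using summable_digits by (rule suminf_split_initial_segment)
  moreover have "(\<Sum>j. digit_value (d (j + k)) * (1/2) ^ Suc (j + k)) =
      (\<Sum>j. (1/2) ^ k * (digit_value (d (j + k)) * (1/2) ^ Suc j))"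
    by (simp add: power_add mult_ac)
  moreover have "\<dots> = (1/2) ^ k * digit_sum (\<lambda>j. d (j + k))"
    unfolding digit_sum_def using summable_digits[of "\<lambda>j. d (j + k)"] by (rule suminf_mult)
  ultimately show ?thesis by simp
qed

lemma abs_digit_sum: "\<bar>digit_sum d\<bar> \<le> 1"
proof -
  have "norm (digit_sum d) \<le> (\<Sum>k. norm (digit_value (d k) * (1/2) ^ Suc k))"
    unfolding digit_sum_def using summable_digits_norm by (rule summable_norm)
  also have "\<dots> \<le> (\<Sum>k. (1/2) ^ Suc k)"
  proof (rule suminf_le)
    show "norm (digit_value (d k) * (1/2) ^ Suc k) \<le> (1/2) ^ Suc k" for k
      using abs_digit_value[of "d k"] by (simp add: abs_mult mult_le_cancel_right2)
    show "summable (\<lambda>k. (1/2::real) ^ Suc k)"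
      using power_half_series by (rule sums_summable)
  qed (rule summable_digits_norm)
  also have "\<dots> = 1"
    using power_half_series by (rule sums_unique[symmetric])
  finally show ?thesis by simp
qed

lemma digit_sum_close:
  assumes "\<And>j. j < k \<Longrightarrow> d j = e j"
  shows "\<bar>digit_sum d - digit_sum e\<bar> \<le> 2 * (1/2) ^ k"
proof -
  have "digit_sum d - digit_sum e =
      (1/2) ^ k * (digit_sum (\<lambda>j. d (j + k)) - digit_sum (\<lambda>j. e (j + k)))"
    using assms by (subst (1 2) digit_sum_split[of _ k]) (simp add: right_diff_distrib)
  moreover have "\<bar>digit_sum (\<lambda>j. d (j + k)) - digit_sum (\<lambda>j. e (j + k))\<bar> \<le> 2"
    using abs_digit_sum[of "\<lambda>j. d (j + k)"] abs_digit_sum[of "\<lambda>j. e (j + k)"] by linarith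
  ultimately show ?thesis
    by (simp add: abs_mult)
qed

definition sd_word :: "nat \<Rightarrow> (nat \<Rightarrow> sd_symbol) \<Rightarrow> nat \<Rightarrow> sd_symbol" where
  "sd_word n d k = (if k < n then d k else if k = n then Point else d (k - 1))"

definition normalized_digits :: "nat \<Rightarrow> (nat \<Rightarrow> sd_symbol) \<Rightarrow> bool" where
  "normalized_digits n d \<longleftrightarrow> (\<forall>k. d k \<noteq> Point) \<and> (n \<ge> 1 \<longrightarrow> d 0 \<noteq> Zero) \<and>
     (n \<ge> 2 \<longrightarrow> (d 0, d 1) \<notin> {(One, MinusOne), (MinusOne, One)})"

text \<open>
  Digits indexed downwards from \<open>n - 1\<close> are reindexed by the natural numbers; absolute
  convergence makes the unordered sum agree with the series.
\<close>

lemma has_sum_digits_iff: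
  "((\<lambda>i. digit_value (a i) * 2 powi i) has_sum x) {..int n - 1} \<longleftrightarrow>
   x = 2 ^ n * digit_sum (\<lambda>k. a (int n - 1 - int k))"
  (is "?L \<longleftrightarrow> x = 2 ^ n * digit_sum ?d")
proof -
  have bij: "bij_betw (\<lambda>k. int n - 1 - int k) UNIV {..int n - 1}"
    by (rule bij_betwI[where g = "\<lambda>i. nat (int n - 1 - i)"]) auto
  have "?L \<longleftrightarrow> ((\<lambda>k. digit_value (?d k) * 2 powi (int n - 1 - int k)) has_sum x) UNIV"
    using has_sum_reindex_bij_betw[OF bij, of "\<lambda>i. digit_value (a i) * 2 powi i" x] by simp
  also have "(\<lambda>k. digit_value (?d k) * 2 powi (int n - 1 - int k)) =
      (\<lambda>k. 2 ^ n * (digit_value (?d k) * (1/2) ^ Suc k))"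
  proof
    fix k
    have "(2::real) powi (int n - 1 - int k) = 2 powi (int n - int (Suc k))"
      by (simp add: algebra_simps)
    also have "\<dots> = 2 powi int n / 2 powi int (Suc k)"
      by (rule power_int_diff) simp
    also have "\<dots> = 2 ^ n * (1/2) ^ Suc k"
      by (simp only: power_int_of_nat power_one_over mult_1_right times_divide_eq_right)
    finally show "digit_value (?d k) * 2 powi (int n - 1 - int k) =
        2 ^ n * (digit_value (?d k) * (1/2) ^ Suc k)" by simp
  qed
  finally have L: "?L \<longleftrightarrow> ((\<lambda>k. 2 ^ n * (digit_value (?d k) * (1/2) ^ Suc k)) has_sum x) UNIV" .
  have "(\<lambda>k. digit_value (?d k) * (1/2) ^ Suc k) sums digit_sum ?d"
    unfolding digit_sum_def using summable_digits by (rule summable_sums)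
  then have "((\<lambda>k. digit_value (?d k) * (1/2) ^ Suc k) has_sum digit_sum ?d) UNIV"
    by (rule norm_summable_imp_has_sum[OF summable_digits_norm])
  then have "((\<lambda>k. 2 ^ n * (digit_value (?d k) * (1/2) ^ Suc k)) has_sum 2 ^ n * digit_sum ?d) UNIV"
    by (rule has_sum_cmult_right)
  then show ?thesis
    unfolding L by (auto dest: has_sum_unique)
qed

lemma sd_expansion_iff:
  "sd_expansion w x \<longleftrightarrow>
     (\<exists>n d. normalized_digits n d \<and> w = sd_word n d \<and> x = 2 ^ n * digit_sum d)"
proof
  assume "sd_expansion w x"
  then obtain N :: int and a where N: "N \<ge> -1" and a: "\<And>i. a i \<noteq> Point"
    "N \<ge> 0 \<longrightarrow> a N \<noteq> Zero" "N \<ge> 1 \<longrightarrow> (a N, a (N - 1)) \<notin> {(One, MinusOne), (MinusOne, One)}"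
    and w: "\<And>k. w k = (if int k \<le> N then a (N - int k) else if int k = N + 1 then Point
                     else a (N + 1 - int k))"
    and x: "((\<lambda>i. digit_value (a i) * 2 powi i) has_sum x) {..N}"
    unfolding sd_expansion_def by blast
  define n where "n = nat (N + 1)"
  have N_eq: "N = int n - 1" using N by (simp add: n_def)
  define d where "d = (\<lambda>k. a (int n - 1 - int k))"
  have "normalized_digits n d"
    using a N_eq unfolding normalized_digits_def d_def by auto
  moreover have "w = sd_word n d"
  proof
    fix k
    have "a (int n - int k) = a (int n - 1 - int (k - 1))" if "k > n"
      using that by (intro arg_cong[of _ _ a]) auto
    then show "w k = sd_word n d k"
      unfolding w sd_word_def d_def N_eq by auto
  qed
  moreover have "x = 2 ^ n * digit_sum d"
    using x unfolding N_eq has_sum_digits_iff d_def .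
  ultimately show "\<exists>n d. normalized_digits n d \<and> w = sd_word n d \<and> x = 2 ^ n * digit_sum d"
    by blast
next
  assume "\<exists>n d. normalized_digits n d \<and> w = sd_word n d \<and> x = 2 ^ n * digit_sum d"
  then obtain n d where d: "normalized_digits n d" and w: "w = sd_word n d"
    and x: "x = 2 ^ n * digit_sum d" by blast
  define a where "a = (\<lambda>i. d (nat (int n - 1 - i)))"
  have "((\<lambda>i. digit_value (a i) * 2 powi i) has_sum x) {..int n - 1}"
    unfolding has_sum_digits_iff x a_def by simp
  moreover have "\<forall>k. w k = (if int k \<le> int n - 1 then a (int n - 1 - int k)
      else if int k = int n - 1 + 1 then Point else a (int n - 1 + 1 - int k))"
    unfolding w sd_word_def a_def by (auto simp: nat_diff_distrib)
  moreover have "\<forall>i. a i \<noteq> Point" "int n - 1 \<ge> 0 \<longrightarrow> a (int n - 1) \<noteq> Zero"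
    "int n - 1 \<ge> 1 \<longrightarrow> (a (int n - 1), a (int n - 1 - 1)) \<notin> {(One, MinusOne), (MinusOne, One)}"
    using d unfolding normalized_digits_def a_def by auto
  ultimately show "sd_expansion w x"
    unfolding sd_expansion_def by (intro exI[of _ "int n - 1"] exI[of _ a]) simp
qed

lemma sd_word_eq_Point_iff: "normalized_digits n d \<Longrightarrow> sd_word n d k = Point \<longleftrightarrow> k = n"
  by (auto simp: sd_word_def normalized_digits_def)

lemma sd_word_skip_Point: "sd_word n d (if k < n then k else Suc k) = d k"
  by (auto simp: sd_word_def)

text \<open>
  The point marks the exponent, so agreement beyond the point forces equal exponents. One symbol less is
  obtained for the digits, since the point occupies a position.
\<close>

lemma sd_words_agree:
  assumes d: "normalized_digits n d" and e: "normalized_digits m e"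
    and "n < i" and agree: "\<And>k. k < i \<Longrightarrow> sd_word n d k = sd_word m e k"
  shows "m = n" and "\<And>k. Suc k < i \<Longrightarrow> d k = e k"
proof -
  show m: "m = n"
    using agree[OF \<open>n < i\<close>] sd_word_eq_Point_iff[OF d, of n] sd_word_eq_Point_iff[OF e, of n] by simp
  fix k assume "Suc k < i"
  then show "d k = e k"
    using agree[of "if k < n then k else Suc k"] unfolding m
    by (simp add: sd_word_skip_Point split: if_splits)
qed

text \<open>
  Normalization forbids leading zeros and the cancelling prefixes \<open>1,-1\<close> and \<open>-1,1\<close>, so the first two
  digits contribute at least \<open>1/2\<close> in absolute value and the rest at most \<open>1/4\<close>. Hence
  the exponent of a name is bounded in terms of the number that it represents. The maximum with \<open>4\<close>
  accounts for exponents below \<open>2\<close>.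
\<close>

lemma normalized_lower_bound:
  assumes d: "normalized_digits n d"
  shows "2 ^ n \<le> max 4 (4 * \<bar>2 ^ n * digit_sum d\<bar>)"
proof (cases "n \<ge> 2")
  case False
  then have "(2::real) ^ n \<le> 2 ^ 1"
    by (intro power_increasing) auto
  then show ?thesis by simp
next
  case True
  have "digit_sum d = digit_value (d 0) / 2 + digit_value (d 1) / 4 + digit_sum (\<lambda>j. d (j + 2)) / 4"
    by (subst digit_sum_split[of d 2]) (simp add: numeral_2_eq_2)
  moreover have "\<bar>digit_sum (\<lambda>j. d (j + 2))\<bar> \<le> 1"
    by (rule abs_digit_sum)
  moreover have "\<bar>digit_value (d 0) / 2 + digit_value (d 1) / 4\<bar> \<ge> 1 / 2"
    using d True unfolding normalized_digits_def
    by (cases "d 0"; cases "d 1") auto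
  ultimately have "\<bar>digit_sum d\<bar> \<ge> 1 / 4"
    by linarith
  then have "2 ^ n * 1 \<le> 2 ^ n * (4 * \<bar>digit_sum d\<bar>)"
    by (intro mult_left_mono) auto
  then have "2 ^ n \<le> 4 * \<bar>2 ^ n * digit_sum d\<bar>"
    by (simp add: abs_mult mult_ac)
  then show ?thesis
    by (rule max.coboundedI2)
qed

section \<open>Greedy expansions\<close>

text \<open>
  The digit nearest to \<open>2 * t\<close>, that is, the one that leaves the smallest remainder.
\<close>

definition greedy_digit :: "real \<Rightarrow> sd_symbol" where
  "greedy_digit t = (if t > 1/4 then One else if t < -1/4 then MinusOne else Zero)"

definition remainder :: "real \<Rightarrow> real" where
  "remainder t = 2 * t - digit_value (greedy_digit t)"

definition greedy_digits :: "real \<Rightarrow> nat \<Rightarrow> sd_symbol" where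
  "greedy_digits t k = greedy_digit ((remainder ^^ k) t)"

text \<open>
  Needed for \<open>b = 3/4\<close>, which leaves room for perturbations, and for \<open>b = 1\<close>, the largest range that
  digits can represent.
\<close>

lemma abs_remainder_le:
  assumes "\<bar>t\<bar> \<le> b" "1/2 \<le> b" "b \<le> 1"
  shows "\<bar>remainder t\<bar> \<le> b"
  using assms by (auto simp: remainder_def greedy_digit_def abs_if split: if_splits)

lemma abs_remainder_funpow_le:
  assumes "\<bar>t\<bar> \<le> b" "1/2 \<le> b" "b \<le> 1"
  shows "\<bar>(remainder ^^ k) t\<bar> \<le> b"
  by (induction k) (use assms abs_remainder_le in auto)

lemma greedy_partial_sum:
  "(\<Sum>j<k. digit_value (greedy_digits t j) * (1/2) ^ Suc j) = t - (1/2) ^ k * (remainder ^^ k) t"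
proof (induction k)
  case (Suc k)
  have "(remainder ^^ Suc k) t = 2 * (remainder ^^ k) t - digit_value (greedy_digits t k)"
    by (simp add: remainder_def greedy_digits_def)
  then show ?case
    unfolding sum.lessThan_Suc Suc by (simp only: power_Suc) (simp add: algebra_simps)
qed simp

lemma digit_sum_greedy:
  assumes "\<bar>t\<bar> \<le> 1"
  shows "digit_sum (greedy_digits t) = t"
proof -
  have "(\<lambda>k. (1/2) ^ k * (remainder ^^ k) t) \<longlonglongrightarrow> 0"
  proof (rule Lim_null_comparison)
    show "\<forall>\<^sub>F k in sequentially. norm ((1/2) ^ k * (remainder ^^ k) t) \<le> (1/2) ^ k"
      using abs_remainder_funpow_le[OF assms] by (simp add: abs_mult)
    show "(\<lambda>k. (1/2::real) ^ k) \<longlonglongrightarrow> 0"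
      by (rule LIMSEQ_power_zero) simp
  qed
  then have "(\<lambda>k. t - (1/2) ^ k * (remainder ^^ k) t) \<longlonglongrightarrow> t - 0"
    by (intro tendsto_intros)
  then have "(\<lambda>k. digit_value (greedy_digits t k) * (1/2) ^ Suc k) sums t"
    unfolding sums_def greedy_partial_sum by simp
  then show ?thesis
    unfolding digit_sum_def by (rule sums_unique[symmetric])
qed

text \<open>
  A first digit \<open>One\<close> chosen at \<open>t > 3/8\<close> leaves a remainder above \<open>-1/4\<close>, so the next digit is not
  \<open>MinusOne\<close>: the normalization conditions hold without being enforced.
\<close>

lemma greedy_leading_digits:
  assumes "\<bar>t\<bar> > 3/8" "\<bar>t\<bar> \<le> 3/4"
  shows "greedy_digits t 0 \<noteq> Zero"
    and "(greedy_digits t 0, greedy_digits t 1) \<notin> {(One, MinusOne), (MinusOne, One)}"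
  using assms by (auto simp: greedy_digits_def remainder_def greedy_digit_def abs_if split: if_splits)

text \<open>
  After \<open>k\<close> greedy digits of \<open>t\<close>, the remainder belonging to \<open>t'\<close> is the greedy remainder of \<open>t\<close>, which
  is at most \<open>3/4\<close>, plus the error magnified by \<open>2 ^ k\<close>, which is at most \<open>1/4\<close>. Their sum is still
  representable.
\<close>

lemma greedy_prefix_extends:
  assumes t: "\<bar>t\<bar> \<le> 3/4" and near: "2 ^ k * \<bar>t' - t\<bar> \<le> 1/4"
  obtains d where "\<And>j. d j \<noteq> Point" "\<And>j. j < k \<Longrightarrow> d j = greedy_digits t j" "digit_sum d = t'"
proof
  define s where "s = 2 ^ k * (t' - t) + (remainder ^^ k) t"
  have "\<bar>2 ^ k * (t' - t)\<bar> \<le> 1/4"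
    using near by (simp add: abs_mult)
  moreover have "\<bar>(remainder ^^ k) t\<bar> \<le> 3/4"
    using abs_remainder_funpow_le[OF t] by simp
  ultimately have s: "\<bar>s\<bar> \<le> 1"
    unfolding s_def by linarith
  define d where "d = (\<lambda>j. if j < k then greedy_digits t j else greedy_digits s (j - k))"
  have "digit_sum d = (\<Sum>j<k. digit_value (greedy_digits t j) * (1/2) ^ Suc j) + (1/2) ^ k * s"
    using digit_sum_greedy[OF s] by (subst digit_sum_split[of _ k]) (simp add: d_def)
  also have "\<dots> = t'"
    unfolding greedy_partial_sum s_def by (simp add: field_simps power_one_over)
  finally show "digit_sum d = t'" .
  show "d j \<noteq> Point" for j
    by (auto simp: d_def greedy_digits_def greedy_digit_def)
  show "d j = greedy_digits t j" if "j < k" for j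
    using that by (simp add: d_def)
qed

section \<open>The signed digit representation\<close>

definition block_length :: "(sd_symbol \<Rightarrow> bool list) \<Rightarrow> nat" where
  "block_length c = length (c Zero)"

definition block :: "(sd_symbol \<Rightarrow> bool list) \<Rightarrow> cantor \<Rightarrow> nat \<Rightarrow> bool list" where
  "block c p k = map (\<lambda>j. bit_at p (k * block_length c + j)) [0..<block_length c]"

definition encode :: "(sd_symbol \<Rightarrow> bool list) \<Rightarrow> (nat \<Rightarrow> sd_symbol) \<Rightarrow> cantor" where
  "encode c w = Cantor (\<lambda>i. c (w (i div block_length c)) ! (i mod block_length c))"

lemma block_eq_if_close:
  assumes "dist p q \<le> (1/2) ^ (m * block_length c)" and "k < m"
  shows "block c p k = block c q k"
proof -
  have "k * block_length c + j < m * block_length c" if "j < block_length c" for j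
  proof -
    have "k * block_length c + j < Suc k * block_length c"
      using that by simp
    also have "\<dots> \<le> m * block_length c"
      using \<open>k < m\<close> by (intro mult_le_mono1) simp
    finally show ?thesis .
  qed
  then show ?thesis
    using assms(1) unfolding dist_cantor_le_iff block_def by simp
qed

context
  fixes c :: "sd_symbol \<Rightarrow> bool list"
  assumes c: "block_code c"
begin

lemma length_code: "length (c s) = block_length c"
  using c unfolding block_code_def block_length_def by metis

lemma code_inject: "c s = c t \<longleftrightarrow> s = t"
  using c unfolding block_code_def by (auto dest: injD)

lemma block_length_pos: "block_length c > 0"
proof (rule ccontr)
  assume "\<not> block_length c > 0"
  then have "c Zero = c One"
    using length_code[of Zero] length_code[of One] by simp
  then show False
    by (simp add: code_inject)
qed

lemma encodes_iff_block: "encodes c p w \<longleftrightarrow> (\<forall>k. c (w k) = block c p k)"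
proof -
  have "(\<forall>j<block_length c. bit_at p (k * block_length c + j) = c (w k) ! j) \<longleftrightarrow> c (w k) = block c p k" for k
    by (auto simp: list_eq_iff_nth_eq length_code block_def)
  then show ?thesis
    unfolding encodes_def length_code by simp
qed

lemma encodes_encode: "encodes c (encode c w) w"
  using block_length_pos by (simp add: encodes_def length_code encode_def)

lemma encode_close:
  assumes "\<And>k. k < m \<Longrightarrow> w k = v k"
  shows "dist (encode c w) (encode c v) \<le> (1/2) ^ m"
  unfolding dist_cantor_le_iff
proof (intro allI impI)
  fix i assume "i < m"
  then have "i div block_length c < m"
    using div_le_dividend le_less_trans by blast
  then show "bit_at (encode c w) i = bit_at (encode c v) i"
    using assms by (simp add: encode_def)
qed

lemma encodes_close:
  assumes "encodes c p w" "encodes c q v" "dist p q \<le> (1/2) ^ (m * block_length c)" "k < m"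
  shows "w k = v k"
  using assms block_eq_if_close[OF assms(3,4)] by (simp add: encodes_iff_block code_inject[symmetric])

lemma rho_sd_iff:
  "(p, x) \<in> rho_sd c \<longleftrightarrow>
     (\<exists>n d. normalized_digits n d \<and> encodes c p (sd_word n d) \<and> x = 2 ^ n * digit_sum d)"
  unfolding rho_sd_def by (auto simp: sd_expansion_iff)

text \<open>
  Agreement up to \<open>k\<close> digits behind the point bounds the error by a multiple of \<open>(1/2) ^ k\<close>. The modulus
  has to depend on the exponent, which is why \<open>\<rho>\<close> is continuous but not uniformly so.
\<close>

lemma rho_sd_continuous_at:
  assumes "(p, x) \<in> rho_sd c" and "\<epsilon> > 0"
  obtains m where "\<And>q y. (q, y) \<in> rho_sd c \<Longrightarrow> dist p q \<le> (1/2) ^ m \<Longrightarrow> \<bar>x - y\<bar> < \<epsilon>"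
proof -
  obtain n d where d: "normalized_digits n d" "encodes c p (sd_word n d)" "x = 2 ^ n * digit_sum d"
    using assms(1) unfolding rho_sd_iff by blast
  obtain k where k: "(1/2) ^ k < \<epsilon>"
    using \<open>\<epsilon> > 0\<close> by (rule half_power_less)
  have "\<bar>x - y\<bar> < \<epsilon>" if q: "(q, y) \<in> rho_sd c"
    and close: "dist p q \<le> (1/2) ^ ((n + k + 2) * block_length c)" for q y
  proof -
    obtain m e where e: "normalized_digits m e" "encodes c q (sd_word m e)" "y = 2 ^ m * digit_sum e"
      using q unfolding rho_sd_iff by blast
    have agree: "sd_word n d j = sd_word m e j" if "j < n + k + 2" for j
      using encodes_close[OF d(2) e(2) close that] .
    have "m = n"
      by (rule sd_words_agree(1)[OF d(1) e(1) _ agree]) auto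
    have "d j = e j" if "j < n + k + 1" for j
      by (rule sd_words_agree(2)[OF d(1) e(1) _ agree]) (use that in auto)
    then have "\<bar>digit_sum d - digit_sum e\<bar> \<le> 2 * (1/2) ^ (n + k + 1)"
      by (rule digit_sum_close)
    then have "2 ^ n * \<bar>digit_sum d - digit_sum e\<bar> \<le> 2 ^ n * (2 * (1/2) ^ (n + k + 1))"
      by (intro mult_left_mono) auto
    also have "\<dots> = (1/2) ^ k"
      by (simp add: power_add power_one_over)
    finally have "2 ^ n * \<bar>digit_sum d - digit_sum e\<bar> \<le> (1/2) ^ k" .
    moreover have "\<bar>x - y\<bar> = 2 ^ n * \<bar>digit_sum d - digit_sum e\<bar>"
      unfolding d(3) e(3) \<open>m = n\<close> by (simp add: abs_mult flip: right_diff_distrib)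
    ultimately show ?thesis
      using k by linarith
  qed
  then show thesis by (rule that)
qed

lemma single_valued_rho_sd: "single_valued (rho_sd c)"
proof (rule single_valuedI)
  fix p x y assume x: "(p, x) \<in> rho_sd c" and y: "(p, y) \<in> rho_sd c"
  show "x = y"
  proof (rule ccontr)
    assume "x \<noteq> y"
    then have "\<bar>x - y\<bar> > 0" by simp
    from rho_sd_continuous_at[OF x this] show False
      using y by (metis dist_self less_irrefl zero_le_power zero_le_divide_1_iff zero_le_numeral)
  qed
qed

lemma rho_sd_graph:
  assumes Q: "Q \<subseteq> Domain (rho_sd c)"
  obtains h where "continuous_on Q h" "rho_sd c \<inter> Q \<times> UNIV = {(p, h p) | p. p \<in> Q}"
proof
  define h where "h p = (THE x. (p, x) \<in> rho_sd c)" for p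
  have h: "h p = x" if "(p, x) \<in> rho_sd c" for p x
    unfolding h_def using that single_valued_rho_sd by (auto dest: single_valuedD)
  have hQ: "(p, h p) \<in> rho_sd c" if "p \<in> Q" for p
    using that Q h by blast
  show "rho_sd c \<inter> Q \<times> UNIV = {(p, h p) | p. p \<in> Q}"
    using h hQ by auto
  show "continuous_on Q h"
    unfolding continuous_on_iff
  proof (intro ballI allI impI)
    fix p and \<epsilon> :: real assume p: "p \<in> Q" and "\<epsilon> > 0"
    obtain m where m: "\<And>q y. (q, y) \<in> rho_sd c \<Longrightarrow> dist p q \<le> (1/2) ^ m \<Longrightarrow> \<bar>h p - y\<bar> < \<epsilon>"
      using rho_sd_continuous_at[OF hQ[OF p] \<open>\<epsilon> > 0\<close>] by blast
    show "\<exists>d>0. \<forall>q\<in>Q. dist q p < d \<longrightarrow> dist (h q) (h p) < \<epsilon>"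
      by (rule exI[of _ "(1/2) ^ m"])
        (use m[OF hQ] in \<open>auto simp: dist_commute dist_real_def abs_minus_commute\<close>)
  qed
qed

text \<open>
  It suffices that the preimage is closed. A limit of names decodes block by block to a word whose
  prefixes are prefixes of approximating names; the exponents of these names are bounded, as \<open>S\<close> is,
  so the point appears within a fixed prefix and does not escape to infinity. The limit is
  thus a name, and by continuity it denotes a limit of points of \<open>S\<close>.
\<close>

lemma compact_rho_sd_preimage:
  assumes S: "compact S"
  shows "compact ((rho_sd c)\<inverse> `` S)" (is "compact ?A")
proof -
  have "p \<in> ?A" if p: "p \<in> closure ?A" for p
  proof -
    have "\<exists>q y n d. (q, y) \<in> rho_sd c \<and> y \<in> S \<and> dist p q \<le> (1/2) ^ (m * block_length c) \<and>
        normalized_digits n d \<and> encodes c q (sd_word n d) \<and> y = 2 ^ n * digit_sum d" for m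
    proof -
      have "(1/2::real) ^ (m * block_length c) > 0" by simp
      then obtain q where "q \<in> ?A" "dist q p < (1/2) ^ (m * block_length c)"
        using p unfolding closure_approachable by blast
      then obtain y where y: "y \<in> S" "(q, y) \<in> rho_sd c" "dist p q \<le> (1/2) ^ (m * block_length c)"
        by (auto simp: dist_commute)
      with y(2)[unfolded rho_sd_iff] show ?thesis by blast
    qed
    then obtain q y n d where q: "\<And>m. (q m, y m) \<in> rho_sd c" "\<And>m. y m \<in> S"
      "\<And>m. dist p (q m) \<le> (1/2) ^ (m * block_length c)"
      and d: "\<And>m. normalized_digits (n m) (d m)" "\<And>m. encodes c (q m) (sd_word (n m) (d m))"
      "\<And>m. y m = 2 ^ n m * digit_sum (d m)"
      by metis
    \<comment> \<open>The \<open>m\<close>-th approximant shares its first \<open>m\<close> blocks with \<open>p\<close>, so symbol \<open>k\<close> of the limit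
      can be read off approximant \<open>k + 1\<close>.\<close>
    define w where "w k = sd_word (n (Suc k)) (d (Suc k)) k" for k
    have code: "c (sd_word (n m) (d m) k) = block c p k" if "k < m" for k m
      using block_eq_if_close[OF q(3) that] d(2)[of m] by (simp add: encodes_iff_block)
    have p_w: "encodes c p w"
      unfolding encodes_iff_block w_def using code by simp
    have w: "sd_word (n m) (d m) k = w k" if "k < m" for k m
      using code[OF that] code[of k "Suc k"] by (simp add: w_def code_inject[symmetric])

    obtain B where B: "\<And>y. y \<in> S \<Longrightarrow> \<bar>y\<bar> \<le> B"
      using compact_imp_bounded[OF S] unfolding bounded_iff by auto
    obtain N where N: "max 4 (4 * B) < 2 ^ N"
      using real_arch_pow[of 2 "max 4 (4 * B)"] by auto
    have bound: "n m < N" for m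
    proof -
      have "2 ^ n m \<le> max 4 (4 * \<bar>y m\<bar>)"
        using normalized_lower_bound[OF d(1)[of m]] d(3)[of m] by simp
      also have "\<dots> \<le> max 4 (4 * B)"
        using B[OF q(2)[of m]] by auto
      also have "\<dots> < 2 ^ N" by (rule N)
      finally show ?thesis by simp
    qed
    define n' where "n' = n N"
    have w_n': "w n' = Point"
      using w[of n' N] bound[of N] sd_word_eq_Point_iff[OF d(1)[of N], of n'] by (simp add: n'_def)
    have n: "n m = n'" if "m \<ge> N" for m
      using w[of n' m] bound[of N] that sd_word_eq_Point_iff[OF d(1)[of m], of n'] w_n'
      by (simp add: n'_def)
    \<comment> \<open>Position \<open>n'\<close> of the limit word is the point, so digits from there on are shifted by one.\<close>
    define d' where "d' k = w (if k < n' then k else Suc k)" for k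
    have d': "d' k = d m k" if "m \<ge> N" "Suc k < m" for k m
    proof -
      have "d' k = sd_word (n m) (d m) (if k < n' then k else Suc k)"
        unfolding d'_def using that by (intro w[symmetric]) auto
      then show ?thesis
        unfolding n[OF that(1)] by (simp only: sd_word_skip_Point)
    qed
    have norm: "normalized_digits n' d'"
    proof -
      have "d' k \<noteq> Point" for k
        using d(1)[of "N + k + 2"] d'[of "N + k + 2" k] by (simp add: normalized_digits_def)
      moreover have "d' 0 = d (N + 3) 0" "d' 1 = d (N + 3) 1" "n (N + 3) = n'"
        using d'[of "N + 3" 0] d'[of "N + 3" 1] n[of "N + 3"] by simp_all
      ultimately show ?thesis
        using d(1)[of "N + 3"] by (simp add: normalized_digits_def)
    qed
    have "w = sd_word n' d'"
      using w_n' by (auto simp: fun_eq_iff sd_word_def d'_def)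
    then have px: "(p, 2 ^ n' * digit_sum d') \<in> rho_sd c" (is "(p, ?x) \<in> _")
      unfolding rho_sd_iff using norm p_w by blast
    have "\<exists>z\<in>S. dist z ?x < \<epsilon>" if \<epsilon>: "\<epsilon> > 0" for \<epsilon>
    proof -
      obtain m where m: "\<And>q y. (q, y) \<in> rho_sd c \<Longrightarrow> dist p q \<le> (1/2) ^ m \<Longrightarrow> \<bar>?x - y\<bar> < \<epsilon>"
        using rho_sd_continuous_at[OF px \<epsilon>] by blast
      have "m \<le> m * block_length c"
        using block_length_pos by simp
      then have "(1/2::real) ^ (m * block_length c) \<le> (1/2) ^ m"
        by (intro power_decreasing) auto
      then have "\<bar>?x - y m\<bar> < \<epsilon>"
        using m[OF q(1)[of m]] q(3)[of m] by linarith
      then show ?thesis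
        using q(2)[of m] by (auto simp: dist_real_def abs_minus_commute)
    qed
    then have "?x \<in> closure S"
      unfolding closure_approachable by blast
    then have "?x \<in> S"
      using compact_imp_closed[OF S] by simp
    then show ?thesis
      using px by blast
  qed
  then have "closed ?A"
    using closure_subset_eq[of ?A] by blast
  then show ?thesis
    using compact_Int_closed[OF compact_cantor, of ?A] by simp
qed

text \<open>
  The constant \<open>3/4\<close> leaves the margin \<open>1/4\<close> for perturbations, and minimality gives, for positive
  exponents, the lower bound \<open>3/8\<close> from which the greedy digits are automatically normalized.
\<close>

definition canonical_exponent :: "real \<Rightarrow> nat" where
  "canonical_exponent x = (LEAST n. \<bar>x\<bar> \<le> 3/4 * 2 ^ n)"

lemma canonical_exponent_bounds:
  shows "\<bar>x / 2 ^ canonical_exponent x\<bar> \<le> 3/4"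
    and "canonical_exponent x > 0 \<Longrightarrow> \<bar>x / 2 ^ canonical_exponent x\<bar> > 3/8"
proof -
  obtain n where "4/3 * \<bar>x\<bar> < 2 ^ n"
    using real_arch_pow[of 2 "4/3 * \<bar>x\<bar>"] by auto
  then have ex: "\<bar>x\<bar> \<le> 3/4 * 2 ^ n" by simp
  have "\<bar>x\<bar> \<le> 3/4 * 2 ^ canonical_exponent x"
    unfolding canonical_exponent_def by (rule LeastI) (rule ex)
  then show "\<bar>x / 2 ^ canonical_exponent x\<bar> \<le> 3/4"
    by (simp add: field_simps)
  assume "canonical_exponent x > 0"
  then obtain k where k: "canonical_exponent x = Suc k"
    using gr0_implies_Suc by blast
  have "\<not> \<bar>x\<bar> \<le> 3/4 * 2 ^ k"
    by (rule not_less_Least) (use k in \<open>simp add: canonical_exponent_def\<close>)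
  then show "\<bar>x / 2 ^ canonical_exponent x\<bar> > 3/8"
    unfolding k by (simp add: field_simps)
qed

text \<open>
  Only the first two digits matter, so any continuation of a greedy prefix of length two is
  normalized as well.
\<close>

lemma normalized_if_greedy_prefix:
  fixes x :: real
  defines "n \<equiv> canonical_exponent x"
  assumes "\<And>j. d j \<noteq> Point" and prefix: "\<And>j. j < 2 \<Longrightarrow> d j = greedy_digits (x / 2 ^ n) j"
  shows "normalized_digits n d"
proof -
  have le: "\<bar>x / 2 ^ n\<bar> \<le> 3/4" and ge: "n > 0 \<Longrightarrow> \<bar>x / 2 ^ n\<bar> > 3/8"
    unfolding n_def by (rule canonical_exponent_bounds)+
  show ?thesis
  proof (cases "n = 0")
    case False
    then have "d 0 \<noteq> Zero \<and> (d 0, d 1) \<notin> {(One, MinusOne), (MinusOne, One)}"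
      using greedy_leading_digits[OF ge le] prefix[of 0] prefix[of 1] by simp
    then show ?thesis
      using assms(2) by (simp add: normalized_digits_def)
  qed (use assms(2) in \<open>simp add: normalized_digits_def\<close>)
qed

definition canonical_name :: "real \<Rightarrow> cantor" where
  "canonical_name x =
     encode c (sd_word (canonical_exponent x) (greedy_digits (x / 2 ^ canonical_exponent x)))"

text \<open>
  The exponent and a prefix of the canonical name of \<open>x\<close> can be kept for \<open>x'\<close>. Two digits more than \<open>m\<close>
  are kept for the normalization, and two more powers of \<open>1/2\<close> in the hypothesis provide the margin
  \<open>1/4\<close>. Scaling by \<open>2 ^ n\<close> only shrinks the error, so the bound is independent of \<open>x\<close>.
\<close>

lemma names_near_canonical_name:
  assumes "\<bar>x' - x\<bar> \<le> (1/2) ^ (m + 4)"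
  obtains q where "(q, x') \<in> rho_sd c" "dist (canonical_name x) q \<le> (1/2) ^ m"
proof -
  define n where "n = canonical_exponent x"
  define t where "t = x / 2 ^ n"
  have t: "\<bar>t\<bar> \<le> 3/4"
    unfolding t_def n_def by (rule canonical_exponent_bounds)
  have "2 ^ (m + 2) * \<bar>x' / 2 ^ n - t\<bar> = 2 ^ (m + 2) * \<bar>x' - x\<bar> / 2 ^ n"
    unfolding t_def by (simp flip: diff_divide_distrib)
  also have "\<dots> \<le> 2 ^ (m + 2) * \<bar>x' - x\<bar> / 1"
    by (intro divide_left_mono) auto
  also have "\<dots> \<le> 2 ^ (m + 2) * (1/2) ^ (m + 4)"
    using assms by simp
  also have "\<dots> = 1/4"
    by (simp add: power_add power_one_over)
  finally have near: "2 ^ (m + 2) * \<bar>x' / 2 ^ n - t\<bar> \<le> 1/4" .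
  obtain d where d: "\<And>j. d j \<noteq> Point" "\<And>j. j < m + 2 \<Longrightarrow> d j = greedy_digits t j"
    "digit_sum d = x' / 2 ^ n"
    using greedy_prefix_extends[OF t near] by blast
  have "normalized_digits n d"
    unfolding n_def by (rule normalized_if_greedy_prefix) (use d in \<open>auto simp: t_def n_def\<close>)
  then have "(encode c (sd_word n d), x') \<in> rho_sd c"
    unfolding rho_sd_iff using d(3) encodes_encode by (intro exI[of _ n] exI[of _ d]) simp
  moreover have "dist (canonical_name x) (encode c (sd_word n d)) \<le> (1/2) ^ m"
    unfolding canonical_name_def n_def[symmetric] t_def[symmetric]
    by (rule encode_close) (use d(2) in \<open>auto simp: sd_word_def\<close>)
  ultimately show thesis by (rule that)
qed

lemma canonical_name: "(canonical_name x, x) \<in> rho_sd c"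
proof -
  have "normalized_digits (canonical_exponent x) (greedy_digits (x / 2 ^ canonical_exponent x))"
    by (rule normalized_if_greedy_prefix) (auto simp: greedy_digits_def greedy_digit_def)
  moreover have "digit_sum (greedy_digits (x / 2 ^ canonical_exponent x)) = x / 2 ^ canonical_exponent x"
    using canonical_exponent_bounds(1)[of x] by (intro digit_sum_greedy) linarith
  ultimately show ?thesis
    unfolding rho_sd_iff canonical_name_def using encodes_encode by fastforce
qed

lemma Domain_rho_sd_converse: "Domain ((rho_sd c)\<inverse>) = UNIV"
  using canonical_name by blast

lemma Henkin_continuous_rho_sd_converse: "Henkin_continuous ((rho_sd c)\<inverse>)"
proof -
  have "\<forall>\<epsilon>. \<exists>m. \<epsilon> > 0 \<longrightarrow> (1/2::real) ^ m < \<epsilon>"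
    using half_power_less by metis
  then obtain m where m: "\<And>\<epsilon>. \<epsilon> > 0 \<Longrightarrow> (1/2::real) ^ m \<epsilon> < \<epsilon>"
    by metis
  show ?thesis
  proof (rule Henkin_continuousI[where \<delta> = "\<lambda>\<epsilon>. (1/2) ^ (m \<epsilon> + 4)" and y = canonical_name])
    show "(x, canonical_name x) \<in> (rho_sd c)\<inverse>" for x
      using canonical_name by simp
    fix \<epsilon> x x' :: real assume "\<epsilon> > 0" and "dist x x' < (1/2) ^ (m \<epsilon> + 4)"
    then have "\<bar>x' - x\<bar> \<le> (1/2) ^ (m \<epsilon> + 4)"
      by (simp add: dist_real_def abs_minus_commute)
    then obtain q where "(q, x') \<in> rho_sd c" "dist (canonical_name x) q \<le> (1/2) ^ m \<epsilon>"
      by (rule names_near_canonical_name)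
    then show "\<exists>q. (x', q) \<in> (rho_sd c)\<inverse> \<and> dist (canonical_name x) q < \<epsilon>"
      using m[OF \<open>\<epsilon> > 0\<close>] by force
  qed simp
qed

end

section \<open>Decoding tapes of fractions\<close>

lemma nat_word_Bits: "\<exists>bs. nat_word n = map Bit bs"
proof (induction n rule: nat_word.induct)
  case (1 n)
  show ?case
  proof (cases "n < 2")
    case True
    then have "nat_word n = map Bit [n = 1]"
      by (subst nat_word.simps) simp
    then show ?thesis by blast
  next
    case False
    then obtain bs where "nat_word (n div 2) = map Bit bs"
      using 1 by blast
    with False have "nat_word n = map Bit (bs @ [odd n])"
      by (subst nat_word.simps) simp
    then show ?thesis by blast
  qed
qed

text \<open>
  The inverse is evaluation of the binary digits.
\<close>

lemma inj_nat_word: "inj nat_word"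
proof (rule inj_on_inverseI)
  fix n
  show "foldl (\<lambda>v s. 2 * v + of_bool (s = Bit True)) 0 (nat_word n) = n"
  proof (induction n rule: nat_word.induct)
    case (1 n)
    then show ?case
      by (subst nat_word.simps) auto
  qed
qed

lemma set_nat_word: "set (nat_word n) \<subseteq> range Bit"
  using nat_word_Bits[of n] by auto

lemma set_int_word: "set (int_word i) \<subseteq> insert Minus (range Bit)"
  using set_nat_word by (auto simp: int_word_def)

lemma inj_int_word: "inj int_word"
proof (rule injI)
  have M: "nat_word n \<noteq> Minus # xs" for xs n
    using set_nat_word[of n] by auto
  have inj: "nat_word m = nat_word n \<longleftrightarrow> m = n" for m n
    using inj_nat_word by (simp add: inj_eq)
  fix i j assume "int_word i = int_word j"
  then show "i = j"
    by (cases "i < 0"; cases "j < 0") (simp_all add: int_word_def inj M M[symmetric])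
qed

lemma append_separator_eqD:
  assumes "xs @ s # ys = xs' @ s # ys'" "s \<notin> set xs" "s \<notin> set xs'"
  shows "xs = xs' \<and> ys = ys'"
  using assms
proof (induction xs arbitrary: xs')
  case Nil
  then show ?case by (cases xs') auto
next
  case (Cons a xs)
  then show ?case by (cases xs') auto
qed

text \<open>
  The words of fractions form a prefix code, because slash and comma occur in them only as
  terminators of the two numbers.
\<close>

lemma frac_word_append_eqD:
  assumes "frac_word r @ xs = frac_word r' @ ys"
  shows "r = r' \<and> xs = ys"
proof -
  have no: "Slash \<notin> set (int_word i)" "Comma \<notin> set (int_word i)" for i
    using set_int_word[of i] by auto
  have "int_word (fst r) @ Slash # int_word (snd r) @ Comma # xs =
      int_word (fst r') @ Slash # int_word (snd r') @ Comma # ys"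
    using assms by (simp add: frac_word_def)
  note num = append_separator_eqD[OF this no(1) no(1)]
  note den = append_separator_eqD[OF conjunct2[OF num] no(2) no(2)]
  have "fst r = fst r'" "snd r = snd r'"
    using num den injD[OF inj_int_word] by blast+
  then show ?thesis
    using den by (simp add: prod_eq_iff)
qed

text \<open>
  The finite tapes, as opposed to the infinite \<open>frac_tape\<close>.
\<close>

definition frac_words :: "(nat \<Rightarrow> int \<times> int) \<Rightarrow> nat \<Rightarrow> frac_symbol list" where
  "frac_words r n = concat (map (\<lambda>i. frac_word (r i)) [0..<n])"

lemma frac_words_add:
  "frac_words r (m + n) = frac_words r m @ frac_words (\<lambda>i. r (m + i)) n"
  by (induction n) (simp_all add: frac_words_def)

lemma length_frac_words: "n \<le> length (frac_words r n)"
proof (induction n)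
  case (Suc n)
  have "length (frac_word (r n)) \<ge> 1"
    by (simp add: frac_word_def)
  then show ?case
    using Suc by (simp add: frac_words_def)
qed simp

lemma frac_words_nth: "n \<le> m \<Longrightarrow> k < length (frac_words r n) \<Longrightarrow> frac_words r m ! k = frac_words r n ! k"
  using frac_words_add[of r n "m - n"] by (simp add: nth_append)

lemma frac_tape_nth:
  assumes "k < length (frac_words r n)"
  shows "frac_tape r k = frac_words r n ! k"
proof -
  have "k < length (frac_words r (Suc k))"
    using length_frac_words[of "Suc k" r] by simp
  then have "frac_words r (max n (Suc k)) ! k = frac_words r (Suc k) ! k"
    by (intro frac_words_nth) auto
  moreover have "frac_words r (max n (Suc k)) ! k = frac_words r n ! k"
    using assms by (intro frac_words_nth) auto
  ultimately show ?thesis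
    by (simp add: frac_tape_def frac_words_def)
qed

lemma frac_tape_cong: "(\<And>i. i \<le> k \<Longrightarrow> r i = r' i) \<Longrightarrow> frac_tape r k = frac_tape r' k"
  unfolding frac_tape_def by (intro arg_cong[of _ _ "\<lambda>l. concat l ! k"] map_cong) auto

lemma frac_words_prefixD:
  assumes "frac_words r n @ xs = frac_words r' n @ ys" "i < n"
  shows "r i = r' i"
  using assms
proof (induction n arbitrary: r r' i)
  case (Suc n)
  have split: "frac_words s (Suc n) = frac_word (s 0) @ frac_words (\<lambda>i. s (Suc i)) n" for s
    using frac_words_add[of s 1 n] by (simp add: frac_words_def)
  have "r 0 = r' 0" and rest: "frac_words (\<lambda>i. r (Suc i)) n @ xs = frac_words (\<lambda>i. r' (Suc i)) n @ ys"
    using frac_word_append_eqD[OF Suc.prems(1)[unfolded split append_assoc]] by simp_all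
  then show ?case
    using Suc.IH[OF rest] Suc.prems(2) by (cases i) auto
qed simp

text \<open>
  This is what makes decoding continuous: by unique decodability, the first \<open>n\<close> fractions are
  recognized from a finite initial part of the tape.
\<close>

lemma frac_tape_determines:
  assumes "\<And>k. k < length (frac_words u n) \<Longrightarrow> frac_tape u k = frac_tape v k" and "i < n"
  shows "u i = v i"
proof -
  define L where "L = length (frac_words u n)"
  \<comment> \<open>Each word is nonempty, so \<open>L\<close> fractions of the other tape certainly cover \<open>L\<close> symbols.\<close>
  define m where "m = max n L"
  have L: "L \<le> length (frac_words v m)"
    using length_frac_words[of m v] by (simp add: m_def)
  have "frac_words u n = take L (frac_words v m)"
  proof (rule nth_equalityI)
    fix k assume "k < length (frac_words u n)"
    then show "frac_words u n ! k = take L (frac_words v m) ! k"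
      using assms(1)[of k] L frac_tape_nth[of k u n] frac_tape_nth[of k v m] by (simp add: L_def)
  qed (use L in \<open>simp add: L_def\<close>)
  then have "frac_words u n @ drop L (frac_words v m) = frac_words v m"
    by simp
  also have "\<dots> = frac_words v n @ frac_words (\<lambda>i. v (n + i)) (m - n)"
    using frac_words_add[of v n "m - n"] by (simp add: m_def)
  finally show ?thesis
    using assms(2) by (rule frac_words_prefixD)
qed

section \<open>Oracle machines are continuous\<close>

lemma run_Suc: "run M A inp (Suc t) = step M A inp (run M A inp t)"
  by (simp add: run_def)

lemma input_pos_run_le: "input_pos (run M A inp t) \<le> t"
proof (induction t)
  case 0
  show ?case by (simp add: run_def initial_config_def)
next
  case (Suc t)
  then show ?case by (simp add: run_Suc step_def Let_def)
qed

text \<open>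
  The input head advances by at most one cell per step, so after \<open>t\<close> steps only the first \<open>t\<close> cells have
  been read. The answers of the oracle depend on the queries only.
\<close>

lemma run_cong:
  assumes "\<And>k. k < t \<Longrightarrow> inp k = inp' k"
  shows "run M A inp t = run M A inp' t"
  using assms
proof (induction t)
  case 0
  show ?case by (simp add: run_def)
next
  case (Suc t)
  have eq: "run M A inp t = run M A inp' t"
    using Suc by simp
  have "inp (input_pos (run M A inp' t)) = inp' (input_pos (run M A inp' t))"
    using Suc.prems input_pos_run_le[of M A inp' t] by (simp add: le_imp_less_Suc)
  then show ?case
    unfolding run_Suc eq step_def by simp
qed

lemma output_tape_mono:
  assumes "s \<le> t"
  shows "\<exists>zs. output_tape (run M A inp t) = output_tape (run M A inp s) @ zs"
  using assms
proof (induction t rule: dec_induct)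
  case (step n)
  then show ?case
    by (auto simp: run_Suc step_def Let_def split: option.splits)
qed simp

lemma produces_nth:
  assumes "produces M A inp out" and "k < length (output_tape (run M A inp t))"
  shows "output_tape (run M A inp t) ! k = out k"
proof -
  obtain s where s: "k < length (output_tape (run M A inp s))" "output_tape (run M A inp s) ! k = out k"
    using assms(1) unfolding produces_def by blast
  obtain zs zs' where
    "output_tape (run M A inp (max s t)) = output_tape (run M A inp s) @ zs"
    "output_tape (run M A inp (max s t)) = output_tape (run M A inp t) @ zs'"
    using output_tape_mono[of s "max s t" M A inp] output_tape_mono[of t "max s t" M A inp] by auto
  then have "(output_tape (run M A inp s) @ zs) ! k = (output_tape (run M A inp t) @ zs') ! k"
    by simp
  then show ?thesis
    using s assms(2) by (simp add: nth_append)
qed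

lemma produces_continuous:
  assumes "produces M A inp out"
  obtains t where "\<And>inp' out'. produces M A inp' out' \<Longrightarrow> (\<And>k. k < t \<Longrightarrow> inp k = inp' k) \<Longrightarrow>
    (\<And>k. k < n \<Longrightarrow> out k = out' k)"
proof -
  obtain t where t: "n < length (output_tape (run M A inp t))"
    using assms unfolding produces_def by blast
  show thesis
  proof (rule that[of t])
    fix inp' out' k
    assume out': "produces M A inp' out'" and "\<And>k. k < t \<Longrightarrow> inp k = inp' k" and "k < n"
    then have "run M A inp t = run M A inp' t"
      by (intro run_cong)
    moreover have "k < length (output_tape (run M A inp t))"
      using \<open>k < n\<close> t by simp
    ultimately show "out k = out' k"
      using produces_nth[OF assms, of k t] produces_nth[OF out', of k t] by simp
  qed
qed

text \<open>
  The rounded value must not depend on \<open>p\<close> itself but only on a prefix of \<open>p\<close>. So \<open>p\<close> is replaced by a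
  chosen representative among the points of \<open>P\<close> with the same prefix before rounding; half of the
  allowed error pays for the replacement and half for the rounding.
\<close>

lemma locally_constant_approximations:
  fixes h :: "cantor \<Rightarrow> real"
  assumes "uniformly_continuous_on P h"
  obtains r where "\<And>p. p \<in> P \<Longrightarrow> approximates (r p) (h p)"
    "\<And>n. \<exists>m. \<forall>p\<in>P. \<forall>q\<in>P. dist p q \<le> (1/2) ^ m \<longrightarrow> r p n = r q n"
proof -
  have "\<exists>m. \<forall>p\<in>P. \<forall>q\<in>P. dist p q \<le> (1/2) ^ m \<longrightarrow> \<bar>h p - h q\<bar> \<le> (1/2) ^ Suc n" for n
  proof -
    have "(1/2::real) ^ Suc n > 0" by simp
    then obtain d where d: "d > 0" "\<And>p q. p \<in> P \<Longrightarrow> q \<in> P \<Longrightarrow> dist q p < d \<Longrightarrow> dist (h q) (h p) < (1/2) ^ Suc n"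
      using assms unfolding uniformly_continuous_on_def by meson
    obtain m where "(1/2) ^ m < d"
      using d(1) by (rule half_power_less)
    then have "\<forall>p\<in>P. \<forall>q\<in>P. dist p q \<le> (1/2) ^ m \<longrightarrow> \<bar>h p - h q\<bar> \<le> (1/2) ^ Suc n"
      using d(2) by (force simp: dist_real_def)
    then show ?thesis by blast
  qed
  then obtain m where m: "\<And>n p q. p \<in> P \<Longrightarrow> q \<in> P \<Longrightarrow> dist p q \<le> (1/2) ^ m n \<Longrightarrow> \<bar>h p - h q\<bar> \<le> (1/2) ^ Suc n"
    by metis
  define rep where "rep p n = (SOME q. q \<in> P \<and> (\<forall>i<m n. bit_at p i = bit_at q i))" for p n
  define r :: "cantor \<Rightarrow> nat \<Rightarrow> int \<times> int" where "r p n = (\<lfloor>2 ^ Suc n * h (rep p n)\<rfloor>, 2 ^ Suc n)" for p n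
  have rep: "rep p n \<in> P \<and> dist p (rep p n) \<le> (1/2) ^ m n" if "p \<in> P" for p n
    unfolding rep_def dist_cantor_le_iff by (rule someI[of _ p]) (use that in simp)
  have "approximates (r p) (h p)" if "p \<in> P" for p
    unfolding approximates_def
  proof (intro allI conjI)
    fix n
    show "snd (r p n) \<noteq> 0" by (simp add: r_def)
    define z where "z = h (rep p n)"
    have "\<bar>h p - z\<bar> \<le> (1/2) ^ Suc n"
      unfolding z_def using that rep[OF that, of n] by (intro m) auto
    moreover have "\<bar>z - of_int \<lfloor>2 ^ Suc n * z\<rfloor> / 2 ^ Suc n\<bar> \<le> (1/2) ^ Suc n"
    proof -
      have "z - of_int \<lfloor>2 ^ Suc n * z\<rfloor> / 2 ^ Suc n = (2 ^ Suc n * z - of_int \<lfloor>2 ^ Suc n * z\<rfloor>) / 2 ^ Suc n"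
        by (simp add: field_simps)
      moreover have "\<bar>2 ^ Suc n * z - of_int \<lfloor>2 ^ Suc n * z\<rfloor>\<bar> \<le> 1"
        by linarith
      ultimately show ?thesis
        by (simp add: abs_divide divide_right_mono power_one_over del: power_Suc)
    qed
    moreover have "(1/2::real) ^ Suc n + (1/2) ^ Suc n = 1 / 2 ^ n"
      by (simp add: power_one_over)
    ultimately have "\<bar>h p - of_int \<lfloor>2 ^ Suc n * z\<rfloor> / 2 ^ Suc n\<bar> \<le> 1 / 2 ^ n"
      by linarith
    then show "\<bar>h p - of_int (fst (r p n)) / of_int (snd (r p n))\<bar> \<le> 1 / 2 ^ n"
      by (simp add: r_def z_def)
  qed
  moreover have "r p n = r q n" if "dist p q \<le> (1/2) ^ m n" for p q n
  proof -
    \<comment> \<open>Equal prefixes give extensionally equal predicates, hence the same choice.\<close>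
    have "rep p n = rep q n"
      using that unfolding rep_def dist_cantor_le_iff by (intro arg_cong[of _ _ Eps]) auto
    then show ?thesis by (simp add: r_def)
  qed
  ultimately show thesis
    using that[of r] by blast
qed

text \<open>
  The machine is run on approximations of \<open>h p\<close> that are locally constant in \<open>p\<close>. To know the value
  \<open>G p\<close> up to \<open>2 * (1/2) ^ n\<close>, the \<open>n\<close>-th output fraction suffices; it is written within finitely many
  steps, which read finitely many input symbols, hence depend on finitely many input fractions and
  finally on a finite prefix of \<open>p\<close>.
\<close>

lemma computable_relative_selection:
  fixes h :: "cantor \<Rightarrow> real"
  assumes "computable_relative A f" and h: "uniformly_continuous_on P h" and dom: "h ` P \<subseteq> Domain f"
  obtains G where "continuous_on P G" "\<And>p. p \<in> P \<Longrightarrow> (h p, G p) \<in> f"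
proof -
  obtain M where M: "\<And>x r. x \<in> Domain f \<Longrightarrow> approximates r x \<Longrightarrow>
      \<exists>u. produces M A (frac_tape r) (frac_tape u) \<and> (\<exists>y \<in> f `` {x}. approximates u y)"
    using assms(1) unfolding computable_relative_def by blast
  obtain r where r: "\<And>p. p \<in> P \<Longrightarrow> approximates (r p) (h p)"
    "\<And>n. \<exists>m. \<forall>p\<in>P. \<forall>q\<in>P. dist p q \<le> (1/2) ^ m \<longrightarrow> r p n = r q n"
    using locally_constant_approximations[OF h] by blast
  have "\<forall>p. \<exists>u y. p \<in> P \<longrightarrow> produces M A (frac_tape (r p)) (frac_tape u) \<and> (h p, y) \<in> f \<and> approximates u y"
    using M r(1) dom by blast
  then obtain u G where u: "\<And>p. p \<in> P \<Longrightarrow> produces M A (frac_tape (r p)) (frac_tape (u p))"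
    and G: "\<And>p. p \<in> P \<Longrightarrow> (h p, G p) \<in> f" "\<And>p. p \<in> P \<Longrightarrow> approximates (u p) (G p)"
    by metis
  obtain m where m: "\<And>n p q. p \<in> P \<Longrightarrow> q \<in> P \<Longrightarrow> dist p q \<le> (1/2) ^ m n \<Longrightarrow> r p n = r q n"
    using r(2) by metis
  have "continuous_on P G"
    unfolding continuous_on_iff
  proof (intro ballI allI impI)
    fix p and \<epsilon> :: real assume p: "p \<in> P" and "\<epsilon> > 0"
    then have "\<epsilon> / 2 > 0" by simp
    then obtain n where n: "(1/2) ^ n < \<epsilon> / 2"
      by (rule half_power_less)
    obtain t where t: "\<And>inp' out' k. produces M A inp' out' \<Longrightarrow> (\<And>k. k < t \<Longrightarrow> frac_tape (r p) k = inp' k) \<Longrightarrow>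
        k < length (frac_words (u p) (Suc n)) \<Longrightarrow> frac_tape (u p) k = out' k"
      using produces_continuous[OF u[OF p], of "length (frac_words (u p) (Suc n))"] by metis
    define N where "N = Max (m ` {..t})"
    have close: "dist (G q) (G p) < \<epsilon>" if q: "q \<in> P" and pq: "dist q p < (1/2) ^ N" for q
    proof -
      have "r p i = r q i" if "i \<le> t" for i
      proof (rule m[OF p q])
        have "m i \<le> N"
          unfolding N_def using that by (intro Max_ge) auto
        then have "(1/2::real) ^ N \<le> (1/2) ^ m i"
          by (intro power_decreasing) auto
        moreover have "dist p q < (1/2) ^ N"
          using pq by (simp add: dist_commute)
        ultimately show "dist p q \<le> (1/2) ^ m i"
          by linarith
      qed
      then have "frac_tape (r p) k = frac_tape (r q) k" if "k < t" for k
        using that by (intro frac_tape_cong) simp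
      then have "frac_tape (u p) k = frac_tape (u q) k" if "k < length (frac_words (u p) (Suc n))" for k
        using t[OF u[OF q]] that by blast
      then have eq: "u p n = u q n"
        by (rule frac_tape_determines[where n = "Suc n"]) simp_all
      have "\<bar>G p - of_int (fst (u q n)) / of_int (snd (u q n))\<bar> \<le> 1 / 2 ^ n"
        using G(2)[OF p] unfolding approximates_def eq[symmetric] by blast
      moreover have "\<bar>G q - of_int (fst (u q n)) / of_int (snd (u q n))\<bar> \<le> 1 / 2 ^ n"
        using G(2)[OF q] unfolding approximates_def by blast
      ultimately have "\<bar>G q - G p\<bar> \<le> 2 * (1 / 2 ^ n)"
        by linarith
      then show ?thesis
        using n by (simp add: dist_real_def power_one_over)
    qed
    show "\<exists>d>0. \<forall>q\<in>P. dist q p < d \<longrightarrow> dist (G q) (G p) < \<epsilon>"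
      by (rule exI[of _ "(1/2) ^ N"]) (use close in simp)
  qed
  then show thesis
    using G(1) by (rule that)
qed

section \<open>Real multifunctions and their multirealizers\<close>

context
  fixes c :: "sd_symbol \<Rightarrow> bool list"
  assumes c: "block_code c"
begin

lemma rho_sd_on_compact:
  assumes "compact Q" "Q \<subseteq> Domain (rho_sd c)"
  shows "Henkin_continuous (rho_sd c \<inter> Q \<times> UNIV)" and "compact_to_compact (rho_sd c \<inter> Q \<times> UNIV)"
proof -
  obtain h where h: "continuous_on Q h" "rho_sd c \<inter> Q \<times> UNIV = {(p, h p) | p. p \<in> Q}"
    by (rule rho_sd_graph[OF c assms(2)])
  show "Henkin_continuous (rho_sd c \<inter> Q \<times> UNIV)"
    unfolding h(2) using compact_uniformly_continuous[OF h(1) assms(1)] by (rule Henkin_continuous_graph)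
  show "compact_to_compact (rho_sd c \<inter> Q \<times> UNIV)"
    unfolding h(2) using h(1) by (rule compact_to_compact_graph)
qed

lemma compact_to_compact_rho_sd_converse: "compact_to_compact ((rho_sd c)\<inverse>)"
  unfolding compact_to_compact_def using compact_rho_sd_preimage[OF c] by blast

text \<open>
  Corestricting to \<open>K\<close> is the same as restricting to the names of points of \<open>K\<close>, again by
  single-valuedness.
\<close>

lemma corestrict_rho_sd_eq: "corestrict (rho_sd c) K = rho_sd c \<inter> ((rho_sd c)\<inverse> `` K) \<times> UNIV"
  using single_valued_rho_sd[OF c] by (auto simp: corestrict_def dest: single_valuedD)

lemma corestrict_rho_sd:
  assumes "compact K"
  shows "Henkin_continuous (corestrict (rho_sd c) K)" and "compact_to_compact (corestrict (rho_sd c) K)"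
proof -
  have "(rho_sd c)\<inverse> `` K \<subseteq> Domain (rho_sd c)" by blast
  then show "Henkin_continuous (corestrict (rho_sd c) K)" "compact_to_compact (corestrict (rho_sd c) K)"
    unfolding corestrict_rho_sd_eq using rho_sd_on_compact compact_rho_sd_preimage[OF c assms] by blast+
qed

lemma corestrict_rho_sd_converse:
  shows "Domain ((corestrict (rho_sd c) K)\<inverse>) = K" "Range ((corestrict (rho_sd c) K)\<inverse>) = (rho_sd c)\<inverse> `` K"
    and "Henkin_continuous ((corestrict (rho_sd c) K)\<inverse>)"
    and "compact_to_compact ((corestrict (rho_sd c) K)\<inverse>)"
proof -
  have ex: "\<exists>p. (p, x) \<in> rho_sd c" for x
    using Domain_rho_sd_converse[OF c] by blast
  then show D: "Domain ((corestrict (rho_sd c) K)\<inverse>) = K"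
    by (auto simp: corestrict_def)
  show "Range ((corestrict (rho_sd c) K)\<inverse>) = (rho_sd c)\<inverse> `` K"
    by (auto simp: corestrict_def)
  have "tightens ((rho_sd c)\<inverse>) ((corestrict (rho_sd c) K)\<inverse>)"
    unfolding tightens_def D using Domain_rho_sd_converse[OF c] by (auto simp: corestrict_def)
  then show "Henkin_continuous ((corestrict (rho_sd c) K)\<inverse>)"
    using Henkin_continuous_if_tightening Henkin_continuous_rho_sd_converse[OF c] by blast
  have "(corestrict (rho_sd c) K)\<inverse> `` S = (rho_sd c)\<inverse> `` S" if "S \<subseteq> K" for S
    using that by (auto simp: corestrict_def)
  then show "compact_to_compact ((corestrict (rho_sd c) K)\<inverse>)"
    unfolding compact_to_compact_def D using compact_rho_sd_preimage[OF c] by simp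
qed

text \<open>
  Since \<open>\<rho>\<close> is single-valued and onto, the domain conditions of the two compositions of multifunctions
  reduce to \<open>\<rho>\<close> mapping into \<open>K\<close>, and relational composition may be used instead.
\<close>

lemma realizer_relation:
  assumes "Domain f = K"
  shows "(rho_sd c)\<inverse> \<circ>\<^sub>m\<^sub>f f \<circ>\<^sub>m\<^sub>f rho_sd c = corestrict (rho_sd c) K O f O (rho_sd c)\<inverse>"
    and "(rho_sd c)\<inverse> \<circ>\<^sub>m\<^sub>f f \<circ>\<^sub>m\<^sub>f corestrict (rho_sd c) K = corestrict (rho_sd c) K O f O (rho_sd c)\<inverse>"
proof -
  have 1: "(rho_sd c)\<inverse> \<circ>\<^sub>m\<^sub>f f = f O (rho_sd c)\<inverse>"
    unfolding mcomp_def Domain_rho_sd_converse[OF c] by auto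
  have D: "Domain (f O (rho_sd c)\<inverse>) = K"
    using assms Domain_rho_sd_converse[OF c] by blast
  have "rho_sd c `` {p} \<subseteq> K" if "(p, x) \<in> rho_sd c" "x \<in> K" for p x
    using that single_valued_rho_sd[OF c] by (auto dest: single_valuedD)
  then show "(rho_sd c)\<inverse> \<circ>\<^sub>m\<^sub>f f \<circ>\<^sub>m\<^sub>f rho_sd c = corestrict (rho_sd c) K O f O (rho_sd c)\<inverse>"
    unfolding 1 unfolding mcomp_def D corestrict_def using assms by blast
  show "(rho_sd c)\<inverse> \<circ>\<^sub>m\<^sub>f f \<circ>\<^sub>m\<^sub>f corestrict (rho_sd c) K = corestrict (rho_sd c) K O f O (rho_sd c)\<inverse>"
    unfolding 1 unfolding mcomp_def D corestrict_def by blast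
qed

lemma Henkin_continuous_if_computable_relative:
  assumes "compact (Domain f)" and "computable_relative A f"
  shows "Henkin_continuous f"
proof -
  define \<rho>K where "\<rho>K = corestrict (rho_sd c) (Domain f)"
  define P where "P = (rho_sd c)\<inverse> `` Domain f"
  have P: "compact P"
    unfolding P_def using c assms(1) by (rule compact_rho_sd_preimage)
  have "P \<subseteq> Domain (rho_sd c)"
    by (auto simp: P_def)
  from c this obtain h where h: "continuous_on P h" "rho_sd c \<inter> P \<times> UNIV = {(p, h p) | p. p \<in> P}"
    by (rule rho_sd_graph)
  have \<rho>K: "\<rho>K = {(p, h p) | p. p \<in> P}"
    using h(2) by (simp only: \<rho>K_def corestrict_rho_sd_eq P_def)
  have dom: "h ` P \<subseteq> Domain f"
    using \<rho>K unfolding \<rho>K_def corestrict_def by auto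
  obtain G where G: "continuous_on P G" "\<And>p. p \<in> P \<Longrightarrow> (h p, G p) \<in> f"
    using computable_relative_selection[OF assms(2) compact_uniformly_continuous[OF h(1) P] dom] by blast
  have "Henkin_continuous (\<rho>K\<inverse> O {(p, G p) | p. p \<in> P})"
  proof (rule Henkin_continuous_relcomp)
    show "Henkin_continuous (\<rho>K\<inverse>)"
      unfolding \<rho>K_def by (rule corestrict_rho_sd_converse)
    show "Henkin_continuous {(p, G p) | p. p \<in> P}"
      using compact_uniformly_continuous[OF G(1) P] by (rule Henkin_continuous_graph)
  qed (auto simp: \<rho>K)
  moreover have "tightens (\<rho>K\<inverse> O {(p, G p) | p. p \<in> P}) f"
  proof -
    have "Range (\<rho>K\<inverse>) \<subseteq> Domain {(p, G p) | p. p \<in> P}"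
      by (auto simp: \<rho>K)
    then have "Domain (\<rho>K\<inverse> O {(p, G p) | p. p \<in> P}) = Domain (\<rho>K\<inverse>)"
      by (rule Domain_relcomp_if_total)
    also have "\<dots> = Domain f"
      unfolding \<rho>K_def by (rule corestrict_rho_sd_converse)
    finally have "Domain (\<rho>K\<inverse> O {(p, G p) | p. p \<in> P}) = Domain f" .
    moreover have "(x, y) \<in> f" if "(x, y) \<in> \<rho>K\<inverse> O {(p, G p) | p. p \<in> P}" for x y
      using that G(2) unfolding \<rho>K by blast
    ultimately show ?thesis
      unfolding tightens_def by blast
  qed
  ultimately show ?thesis
    by (rule Henkin_continuous_if_tightening)
qed

text \<open>
  Restricting \<open>\<rho>\<close> to the image \<open>Q\<close> of the names under \<open>F\<close> is the step that uses preservation of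
  compactness by \<open>F\<close>: on the compact set \<open>Q\<close>, the function \<open>\<rho>\<close> is uniformly continuous.
\<close>

lemma Henkin_continuous_tightening_if_multirealizer:
  assumes "compact (Domain f)" and F: "multirealizer c F f" "Henkin_continuous F" "compact_to_compact F"
  obtains g where "Domain g = Domain f" "tightens g f" "Henkin_continuous g" "compact_to_compact g"
proof -
  define P where "P = (rho_sd c)\<inverse> `` Domain f"
  define inv_rho where "inv_rho = (corestrict (rho_sd c) (Domain f))\<inverse>"
  have inv_rho: "Domain inv_rho = Domain f" "Range inv_rho = P" "Henkin_continuous inv_rho"
    "compact_to_compact inv_rho"
    unfolding inv_rho_def P_def by (rule corestrict_rho_sd_converse)+
  have "compact P"
    unfolding P_def using c assms(1) by (rule compact_rho_sd_preimage)
  have P_eq: "P = Domain (corestrict (rho_sd c) (Domain f) O f O (rho_sd c)\<inverse>)"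
  proof -
    have "\<exists>q. (q, y) \<in> rho_sd c" for y
      using Domain_rho_sd_converse[OF c] by blast
    then show ?thesis
      unfolding P_def corestrict_def by blast
  qed
  have tight: "tightens F (corestrict (rho_sd c) (Domain f) O f O (rho_sd c)\<inverse>)"
    using F(1) unfolding multirealizer_def realizer_relation(1)[OF refl] .
  have P: "P \<subseteq> Domain F"
    using tight unfolding tightens_def P_eq by blast
  have F_sub: "(p, q) \<in> corestrict (rho_sd c) (Domain f) O f O (rho_sd c)\<inverse>" if "p \<in> P" "(p, q) \<in> F" for p q
    using tight that unfolding tightens_def P_eq[symmetric] by blast
  define Q where "Q = F `` P"
  have "compact Q"
    unfolding Q_def using F(3) P \<open>compact P\<close> by (simp add: compact_to_compact_def)
  have Q: "Q \<subseteq> Domain (rho_sd c)"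
    using F_sub by (auto simp: Q_def)
  define FP where "FP = F \<inter> P \<times> UNIV"
  define out where "out = rho_sd c \<inter> Q \<times> UNIV"
  have dom: "Domain FP = P" "Range FP = Q" "Domain out = Q"
    using P Q unfolding FP_def out_def Q_def by blast+
  have "tightens F FP"
    unfolding tightens_def dom using P by (auto simp: FP_def)
  then have FP': "Henkin_continuous FP"
    using F(2) Henkin_continuous_if_tightening by blast
  have "FP `` S = F `` S" if "S \<subseteq> P" for S
    using that by (auto simp: FP_def)
  then have FP'': "compact_to_compact FP"
    unfolding compact_to_compact_def dom using F(3) P
    by (metis compact_to_compact_def subset_trans)
  define g where "g = (inv_rho O FP) O out"
  show thesis
  proof (rule that)
    have R: "Range inv_rho \<subseteq> Domain FP" "Range (inv_rho O FP) \<subseteq> Domain out"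
      using inv_rho(2) dom by blast+
    show dom_g: "Domain g = Domain f"
      unfolding g_def Domain_relcomp_if_total[OF R(2)] Domain_relcomp_if_total[OF R(1)] inv_rho(1) ..
    have "(x, y) \<in> f" if xy: "(x, y) \<in> g" for x y
    proof -
      obtain p q where p: "(p, x) \<in> rho_sd c" "p \<in> P" "(p, q) \<in> F" and q: "(q, y) \<in> rho_sd c"
        using xy by (auto simp: g_def inv_rho_def FP_def out_def corestrict_def)
      obtain x' y' where "(p, x') \<in> rho_sd c" "(x', y') \<in> f" "(q, y') \<in> rho_sd c"
        using F_sub[OF p(2,3)] by (auto simp: corestrict_def)
      then show ?thesis
        using p(1) q single_valued_rho_sd[OF c] by (metis single_valuedD)
    qed
    then show "tightens g f"
      unfolding tightens_def dom_g by blast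
    have out: "Henkin_continuous out" "compact_to_compact out"
      unfolding out_def using \<open>compact Q\<close> Q by (rule rho_sd_on_compact)+
    show "Henkin_continuous g"
      unfolding g_def by (intro Henkin_continuous_relcomp R inv_rho FP' out)
    show "compact_to_compact g"
      unfolding g_def by (intro compact_to_compact_relcomp R inv_rho FP'' out)
  qed
qed

lemma multirealizer_if_Henkin_continuous:
  assumes "compact (Domain f)" "Henkin_continuous f" "compact_to_compact f"
  defines "F \<equiv> (rho_sd c)\<inverse> \<circ>\<^sub>m\<^sub>f f \<circ>\<^sub>m\<^sub>f corestrict (rho_sd c) (Domain f)"
  shows "multirealizer c F f" and "Henkin_continuous F" and "compact_to_compact F"
proof -
  have F: "F = corestrict (rho_sd c) (Domain f) O f O (rho_sd c)\<inverse>"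
    unfolding F_def by (rule realizer_relation(2)) simp
  show "multirealizer c F f"
    unfolding multirealizer_def F realizer_relation(1)[OF refl] by (simp add: tightens_def)
  have R: "Range f \<subseteq> Domain ((rho_sd c)\<inverse>)"
    unfolding Domain_rho_sd_converse[OF c] by (rule subset_UNIV)
  have R': "Range (corestrict (rho_sd c) (Domain f)) \<subseteq> Domain (f O (rho_sd c)\<inverse>)"
    unfolding Domain_relcomp_if_total[OF R] by (auto simp: corestrict_def)
  show "Henkin_continuous F"
    unfolding F
    by (intro Henkin_continuous_relcomp R R' assms(2) corestrict_rho_sd(1)[OF assms(1)]
        Henkin_continuous_rho_sd_converse[OF c])
  show "compact_to_compact F"
    unfolding F
    by (intro compact_to_compact_relcomp R R' assms(3) corestrict_rho_sd(2)[OF assms(1)]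
        compact_to_compact_rho_sd_converse)
qed

end

theorem theorem18:
  fixes K :: "real set" and c :: "sd_symbol \<Rightarrow> bool list"
  assumes "compact K" and "block_code c"
  shows "(\<forall>f :: (real \<times> real) set.
            Domain f = K \<and> (\<exists>A. computable_relative A f) \<longrightarrow> Henkin_continuous f) \<and>
         (\<forall>(f :: (real \<times> real) set) (F :: (cantor \<times> cantor) set).
            Domain f = K \<and> multirealizer c F f \<and> Henkin_continuous F \<and> compact_to_compact F \<longrightarrow>
              Henkin_continuous f \<and>
              (\<exists>g. Domain g = K \<and> tightens g f \<and> Henkin_continuous g \<and> compact_to_compact g)) \<and>
         (\<forall>f :: (real \<times> real) set.
            Domain f = K \<and> Henkin_continuous f \<and> compact_to_compact f \<longrightarrow>
              (let F = (rho_sd c)\<inverse> \<circ>\<^sub>m\<^sub>f f \<circ>\<^sub>m\<^sub>f corestrict (rho_sd c) K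
               in multirealizer c F f \<and> Henkin_continuous F \<and> compact_to_compact F))"
proof (intro conjI allI impI)
  fix f :: "(real \<times> real) set"
  assume "Domain f = K \<and> (\<exists>A. computable_relative A f)"
  then show "Henkin_continuous f"
    using Henkin_continuous_if_computable_relative[OF assms(2)] assms(1) by blast
next
  fix f :: "(real \<times> real) set" and F :: "(cantor \<times> cantor) set"
  assume F: "Domain f = K \<and> multirealizer c F f \<and> Henkin_continuous F \<and> compact_to_compact F"
  then obtain g where g: "Domain g = K" "tightens g f" "Henkin_continuous g" "compact_to_compact g"
    using Henkin_continuous_tightening_if_multirealizer[OF assms(2), of f F] assms(1) by metis
  then show "\<exists>g. Domain g = K \<and> tightens g f \<and> Henkin_continuous g \<and> compact_to_compact g"
    by blast
  show "Henkin_continuous f"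
    using g(3,2) by (rule Henkin_continuous_if_tightening)
next
  fix f :: "(real \<times> real) set"
  assume "Domain f = K \<and> Henkin_continuous f \<and> compact_to_compact f"
  then show "let F = (rho_sd c)\<inverse> \<circ>\<^sub>m\<^sub>f f \<circ>\<^sub>m\<^sub>f corestrict (rho_sd c) K
      in multirealizer c F f \<and> Henkin_continuous F \<and> compact_to_compact F"
    using multirealizer_if_Henkin_continuous[OF assms(2), of f] assms(1) by (auto simp: Let_def)
qed

end
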